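(* Let $\Gamma$ be a Fuchsian group of the first kind, let $k$ be a nonzero real number, let $\nu$ be a multiplier system of weight $k$ for $\Gamma$, and let $f\in M_u(\Gamma,k,\nu)$ be an unrestricted automorphic form of weight $k$ and multiplier system $\nu$ for $\Gamma$. Then $f$ has infinitely many non $\Gamma$-equivalent critical points in $\mathbb{H}$.
   Context: $\mathbb{H}$ is the upper half-plane; $\mathrm{PSL}_2(\mathbb{R})=\mathrm{SL}_2(\mathbb{R})/\{\pm I\}$ acts on $\mathbb{H}\cup\mathbb{R}\cup\{\infty\}$ by Möbius transformations. A Fuchsian group is a discrete subgroup $\Gamma$ of $\mathrm{PSL}_2(\mathbb{R})$; its limit set is the set of all limit points of orbits $\Gamma z$, $z\in\mathbb{H}$; it is of the first kind if its limit set is $\mathbb{R}\cup\{\infty\}$. Let $\widetilde\Gamma\subset\mathrm{SL}_2(\mathbb{R})$ be the preimage of $\Gamma$. Real powers $(cz+d)^k$ are taken with the principal branch of the logarithm. A multiplier system of weight $k\in\mathbb{R}$ for $\Gamma$ is a function $\nu:\widetilde\Gamma\to\{w\in\mathbb{C}:|w|=1\}$ such that $\mu_\gamma(z)=\nu(\gamma)(cz+d)^k$, for $\gamma=\begin{pmatrix}a&b\\c&d\end{pmatrix}\in\widetilde\Gamma$ and $z\in\mathbb{H}$, satisfies $\mu_{\alpha\gamma}(z)=\mu_\alpha(\gamma z)\mu_\gamma(z)$ and $\mu_{-\gamma}(z)=\mu_\gamma(z)$ for all $\alpha,\gamma\in\widetilde\Gamma$, $z\in\mathbb{H}$. $M_u(\Gamma,k,\nu)$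 is the space of unrestricted automorphic forms of weight $k$ and multiplier system $\nu$, i.e. meromorphic functions $f$ on $\mathbb{H}$ with $(cz+d)^{-k}f(\gamma z)=\nu(\gamma)f(z)$ for all $\gamma=\begin{pmatrix}a&b\\c&d\end{pmatrix}\in\widetilde\Gamma$. A critical point of $f$ is a zero in $\mathbb{H}$ of the derivative $f'$. Points $z,w\in\mathbb{H}$ are $\Gamma$-equivalent if $w=\gamma z$ for some $\gamma\in\Gamma$. *)

theory Defs
  imports "HOL-Complex_Analysis.Complex_Analysis" "HOL-Algebra.Coset"
begin

definition SL2R :: "(real^2^2) monoid" where
  "SL2R = \<lparr>carrier = {A. det A = 1}, mult = (**), one = mat 1\<rparr>"

definition PSL2R :: "(real^2^2) set monoid" where
  "PSL2R = SL2R Mod {mat 1, - mat 1}"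

text \<open>Elements of \<open>PSL2R\<close> are cosets \<open>{A, - A}\<close>, so for a subset \<open>U\<close> of \<open>PSL2R\<close> the preimage in
  \<open>SL2R\<close> under the quotient map is \<open>\<Union>U\<close>. In particular \<open>\<Union>\<Gamma>\<close> is the preimage of a
  subgroup \<open>\<Gamma>\<close>.\<close>

definition PSL2R_topology :: "(real^2^2) set topology" where
  "PSL2R_topology =
     topology (\<lambda>U. U \<subseteq> carrier PSL2R \<and> openin (top_of_set (carrier SL2R)) (\<Union>U))"

definition fuchsian_group :: "(real^2^2) set set \<Rightarrow> bool" where
  "fuchsian_group \<Gamma> \<longleftrightarrow>
     subgroup \<Gamma> PSL2R \<and> subtopology PSL2R_topology \<Gamma> = discrete_topology \<Gamma>"

definition upper_half_plane :: "complex set" where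
  "upper_half_plane = {z. Im z > 0}"

definition automorphy_denom :: "real^2^2 \<Rightarrow> complex \<Rightarrow> complex" where
  "automorphy_denom A z = of_real (A $ 2 $ 1) * z + of_real (A $ 2 $ 2)"

definition moebius :: "real^2^2 \<Rightarrow> complex \<Rightarrow> complex" where
  "moebius A z = (of_real (A $ 1 $ 1) * z + of_real (A $ 1 $ 2)) / automorphy_denom A z"

definition orbit :: "(real^2^2) set set \<Rightarrow> complex \<Rightarrow> complex set" where
  "orbit \<Gamma> z = {moebius A z | A. A \<in> \<Union>\<Gamma>}"

definition equivalent_points :: "(real^2^2) set set \<Rightarrow> complex \<Rightarrow> complex \<Rightarrow> bool" where
  "equivalent_points \<Gamma> z w \<longleftrightarrow> w \<in> orbit \<Gamma> z"

text \<open>Limit points are taken in the Riemann sphere, realised as the one-point compactification of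
  the complex plane with \<open>None\<close> as the point at infinity.\<close>

definition limit_set :: "(real^2^2) set set \<Rightarrow> complex option set" where
  "limit_set \<Gamma> =
     (\<Union>z\<in>upper_half_plane.
        Alexandroff_compactification euclidean derived_set_of (Some ` orbit \<Gamma> z))"

definition first_kind :: "(real^2^2) set set \<Rightarrow> bool" where
  "first_kind \<Gamma> \<longleftrightarrow> limit_set \<Gamma> = insert None (Some ` \<real>)"

text \<open>Complex \<open>powr\<close> uses the principal branch \<open>Ln\<close>, with imaginary part in the interval from
  \<open>-\<pi>\<close> (excluded) to \<open>\<pi>\<close> (included).\<close>

definition automorphy_factor ::
    "real \<Rightarrow> (real^2^2 \<Rightarrow> complex) \<Rightarrow> real^2^2 \<Rightarrow> complex \<Rightarrow> complex" where
  "automorphy_factor k \<nu> A z = \<nu> A * automorphy_denom A z powr of_real k"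

definition multiplier_system ::
    "(real^2^2) set set \<Rightarrow> real \<Rightarrow> (real^2^2 \<Rightarrow> complex) \<Rightarrow> bool" where
  "multiplier_system \<Gamma> k \<nu> \<longleftrightarrow>
     (\<forall>A\<in>\<Union>\<Gamma>. norm (\<nu> A) = 1) \<and>
     (\<forall>A\<in>\<Union>\<Gamma>. \<forall>B\<in>\<Union>\<Gamma>. \<forall>z\<in>upper_half_plane.
        automorphy_factor k \<nu> (A ** B) z =
          automorphy_factor k \<nu> A (moebius B z) * automorphy_factor k \<nu> B z) \<and>
     (\<forall>A\<in>\<Union>\<Gamma>. \<forall>z\<in>upper_half_plane.
        automorphy_factor k \<nu> (- A) z = automorphy_factor k \<nu> A z)"

text \<open>A meromorphic function is represented by its normalised total version: it is continuous
  wherever it has no pole and takes the value 0 at poles. The factors in the transformation law are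
  holomorphic and nonvanishing, so the law sends poles to poles and there reads \<open>0 = 0\<close>.\<close>

definition unrestricted_forms ::
    "(real^2^2) set set \<Rightarrow> real \<Rightarrow> (real^2^2 \<Rightarrow> complex) \<Rightarrow> (complex \<Rightarrow> complex) set" where
  "unrestricted_forms \<Gamma> k \<nu> =
     {f. f nicely_meromorphic_on upper_half_plane \<and>
         (\<forall>A\<in>\<Union>\<Gamma>. \<forall>z\<in>upper_half_plane.
            automorphy_denom A z powr (- of_real k) * f (moebius A z) = \<nu> A * f z)}"

text \<open>A normalised meromorphic function is discontinuous at its poles, so poles are never critical
  points.\<close>

definition critical_points :: "(complex \<Rightarrow> complex) \<Rightarrow> complex set" where
  "critical_points f = {z \<in> upper_half_plane. (f has_field_derivative 0) (at z)}"

lemma group_SL2R: "group SL2R"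
proof (rule groupI)
  fix A assume "A \<in> carrier SL2R"
  then have d: "det A = 1" by (simp add: SL2R_def)
  then obtain B where B: "A ** B = mat 1" "B ** A = mat 1"
    using invertible_det_nz[of A] by (auto simp: invertible_def)
  have "det B * det A = 1" using B(2) by (metis det_mul det_I)
  then show "\<exists>B\<in>carrier SL2R. B \<otimes>\<^bsub>SL2R\<^esub> A = \<one>\<^bsub>SL2R\<^esub>"
    using B d by (auto simp: SL2R_def)
qed (auto simp: SL2R_def det_mul det_I matrix_mul_assoc)

lemma det_uminus_2: "det (- A) = det (A :: real^2^2)"
  by (simp add: det_2)

lemma uminus_matrix_mult: "(- A) ** B = - (A ** (B :: real^2^2))" 
  by (simp add: vec_eq_iff matrix_matrix_mult_def sum_negf)

lemma matrix_mult_uminus: "A ** (- B) = - (A ** (B :: real^2^2))" 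
  by (simp add: vec_eq_iff matrix_matrix_mult_def sum_negf)

lemma normal_center_SL2R: "{mat 1, - mat 1} \<lhd> SL2R"
proof -
  interpret group SL2R by (rule group_SL2R)
  have inv_neg: "inv\<^bsub>SL2R\<^esub> (- mat 1) = - mat 1"
    by (rule inv_equality)
       (auto simp: SL2R_def det_uminus_2 uminus_matrix_mult matrix_mult_uminus det_I)
  have "subgroup {mat 1, - mat 1} SL2R"
  proof (rule subgroupI)
    fix A assume "A \<in> {mat 1, - mat 1 :: real^2^2}"
    moreover have "inv\<^bsub>SL2R\<^esub> (mat 1) = mat 1"
      using inv_one by (simp add: SL2R_def)
    ultimately show "inv\<^bsub>SL2R\<^esub> A \<in> {mat 1, - mat 1}" using inv_neg by auto
  qed (auto simp: SL2R_def det_uminus_2 uminus_matrix_mult matrix_mult_uminus det_I)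
  then show ?thesis
    by (auto simp: normal_def normal_axioms_def group_SL2R r_coset_def l_coset_def)
       (auto simp: SL2R_def uminus_matrix_mult matrix_mult_uminus)
qed

lemma group_PSL2R: "group PSL2R"
  unfolding PSL2R_def by (rule normal.factorgroup_is_group[OF normal_center_SL2R])

lemma carrier_PSL2R: "carrier PSL2R = {{A, - A} | A. det A = 1}"
  by (auto simp: PSL2R_def FactGroup_def RCOSETS_def r_coset_def SL2R_def uminus_matrix_mult)

lemma openin_PSL2R_topology:
  "openin PSL2R_topology U \<longleftrightarrow>
     U \<subseteq> carrier PSL2R \<and> openin (top_of_set (carrier SL2R)) (\<Union>U)"
proof -
  have disj: "X = Y" if "X \<in> carrier PSL2R" "Y \<in> carrier PSL2R" "A \<in> X" "A \<in> Y" for X Y A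
    using that by (auto simp: carrier_PSL2R)
  have "istopology (\<lambda>U. U \<subseteq> carrier PSL2R \<and> openin (top_of_set (carrier SL2R)) (\<Union>U))"
    unfolding istopology_def
  proof (intro conjI allI impI)
    fix S T
    assume S: "S \<subseteq> carrier PSL2R \<and> openin (top_of_set (carrier SL2R)) (\<Union>S)"
      and T: "T \<subseteq> carrier PSL2R \<and> openin (top_of_set (carrier SL2R)) (\<Union>T)"
    then show "S \<inter> T \<subseteq> carrier PSL2R" by blast
    have "\<Union>(S \<inter> T) = \<Union>S \<inter> \<Union>T"
    proof
      show "\<Union>S \<inter> \<Union>T \<subseteq> \<Union>(S \<inter> T)"
      proof
        fix A assume "A \<in> \<Union>S \<inter> \<Union>T"
        then obtain X Y where XY: "X \<in> S" "Y \<in> T" "A \<in> X" "A \<in> Y" by blast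
        then have "X = Y" using disj S T by blast
        then show "A \<in> \<Union>(S \<inter> T)" using XY by blast
      qed
    qed blast
    then show "openin (top_of_set (carrier SL2R)) (\<Union>(S \<inter> T))"
      using S T openin_Int by metis
  next
    fix K
    assume K: "\<forall>U\<in>K. U \<subseteq> carrier PSL2R \<and> openin (top_of_set (carrier SL2R)) (\<Union>U)"
    then show "\<Union>K \<subseteq> carrier PSL2R" by blast
    have "\<Union>(\<Union>K) = \<Union>(Union ` K)" by blast
    then show "openin (top_of_set (carrier SL2R)) (\<Union>(\<Union>K))"
      using K openin_Union[of "Union ` K"] by auto
  qed
  then show ?thesis by (simp add: PSL2R_topology_def)
qed

end

theory Submission
  imports Defs
begin

text \<open>Attach to \<open>f\<close> the map \<open>h(z) = z + k f(z) / f'(z)\<close>. The transformation law of \<open>f\<close> makes \<open>h\<close>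
  commute with \<open>\<Gamma>\<close>, and \<open>f'(\<gamma> z) = 0\<close> at a point with \<open>f(z) \<noteq> 0\<close> means exactly \<open>h(z) = \<gamma>\<^sup>-\<^sup>1 \<infinity>\<close>.

  If \<open>h\<close> takes a real value at some point, then it is open there, because the elements of \<open>\<Gamma>\<close> have no
  common fixed point. As \<open>\<Gamma> \<infinity>\<close> is dense in \<open>\<real>\<close>, it takes infinitely many values \<open>\<gamma>\<^sup>-\<^sup>1 \<infinity>\<close> in a compact
  neighbourhood, where every orbit is finite; this gives infinitely many inequivalent critical points. The
  value \<open>\<infinity>\<close> is moved to a real one by \<open>\<Gamma>\<close>.

  Otherwise \<open>h\<close> is holomorphic, also at the zeros and poles of \<open>f\<close>, and maps the upper half-plane into itself
  or into the lower half-plane. It commutes with a hyperbolic element of \<open>\<Gamma>\<close>, so equality holds in the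
  Schwarz--Pick lemma along its axis, and after conjugation \<open>h(z) = r z\<close> with \<open>r\<close> real. Here \<open>r = 1\<close> would
  force \<open>f = 0\<close>, and \<open>r \<noteq> 1\<close> would force all of \<open>\<Gamma>\<close> to preserve the axis.\<close>

text \<open>The formula for \<open>h\<close> comes from the logarithmic derivative. For \<gamma> =
  (a, b; c, d) the transformation law gives f'/f (\<gamma> z) = (c z + d)^2 f'/f (z) + k c (c z +
  d), in which the multiplier has cancelled. When w and z are both moved by \<gamma>, the quantity k
  / (w - z) changes by the same rule. Solving k / (w - z) = f'(z) / f(z) for w therefore gives a map
  that commutes with \<Gamma>; for k = 0 it would degenerate to w = z.

  The quotient by \<Gamma> may have infinite area, so zeros and poles cannot be counted over a
  fundamental domain. Two facts about \<Gamma> carry the proof instead: bounded entries leave only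
  finitely many matrices, and every orbit accumulates at every real number. The hyperbolic element,
  the absence of a common fixed point and the density of \<Gamma> \<infinity> are all drawn from
  them. Accumulation alone does not exclude a common fixed point: the real affine maps have it and
  all fix \<infinity>. Discreteness enters there.

  Failure of the theorem is used as local finiteness: a compact set contains only finitely many
  points whose orbit has a critical point.\<close>

no_notation fps_nth (infixl \<open>$\<close> 75)

section \<open>Moebius transformations\<close>

definition mat2 :: "real \<Rightarrow> real \<Rightarrow> real \<Rightarrow> real \<Rightarrow> real^2^2" where
  "mat2 a b c d = vector [vector [a, b], vector [c, d]]"

lemma mat2_nth [simp]:
  "mat2 a b c d $ 1 $ 1 = a" "mat2 a b c d $ 1 $ 2 = b"
  "mat2 a b c d $ 2 $ 1 = c" "mat2 a b c d $ 2 $ 2 = d"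
  by (simp_all add: mat2_def)

lemma mat2_eqI:
  fixes A B :: "real^2^2"
  assumes "A $ 1 $ 1 = B $ 1 $ 1" "A $ 1 $ 2 = B $ 1 $ 2" "A $ 2 $ 1 = B $ 2 $ 1" "A $ 2 $ 2 = B $ 2 $ 2"
  shows "A = (B :: real^2^2)"
  using assms by (simp add: vec_eq_iff forall_2)

lemma mult2_nth:
  fixes A B :: "real^2^2"
  shows "(A ** B) $ i $ j = A $ i $ 1 * B $ 1 $ j + A $ i $ 2 * B $ 2 $ j"
  by (simp add: matrix_matrix_mult_def sum_2)

lemma mat1_nth2:
  "(mat 1 :: real^2^2) $ 1 $ 1 = 1" "(mat 1 :: real^2^2) $ 1 $ 2 = 0"
  "(mat 1 :: real^2^2) $ 2 $ 1 = 0" "(mat 1 :: real^2^2) $ 2 $ 2 = 1"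
  by (simp_all add: mat_def)

text \<open>The inverse of a matrix of determinant 1, written in the entries so that its continuity
  is immediate.\<close>

definition adj2 :: "real^2^2 \<Rightarrow> real^2^2" where
  "adj2 A = mat2 (A $ 2 $ 2) (- A $ 1 $ 2) (- A $ 2 $ 1) (A $ 1 $ 1)"

lemma adj2_nth [simp]:
  "adj2 A $ 1 $ 1 = A $ 2 $ 2" "adj2 A $ 1 $ 2 = - A $ 1 $ 2"
  "adj2 A $ 2 $ 1 = - A $ 2 $ 1" "adj2 A $ 2 $ 2 = A $ 1 $ 1"
  by (simp_all add: adj2_def)

lemma det_adj2 [simp]: "det (adj2 A) = det A"
  by (simp add: det_2)

lemma adj2_mult: "det A = 1 \<Longrightarrow> adj2 A ** A = mat 1" "det A = 1 \<Longrightarrow> A ** adj2 A = mat 1"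
  by (rule mat2_eqI; simp add: mult2_nth mat1_nth2 det_2 algebra_simps)+

lemma det2_of_real:
  fixes A :: "real^2^2"
  assumes "det A = 1"
  shows "complex_of_real (A $ 1 $ 1) * of_real (A $ 2 $ 2) - of_real (A $ 1 $ 2) * of_real (A $ 2 $ 1) = 1"
proof -
  have "A $ 1 $ 1 * A $ 2 $ 2 - A $ 1 $ 2 * A $ 2 $ 1 = 1" using assms unfolding det_2 .
  then have "complex_of_real (A $ 1 $ 1 * A $ 2 $ 2 - A $ 1 $ 2 * A $ 2 $ 1) = of_real 1" by (rule arg_cong)
  then show ?thesis by (simp only: of_real_diff of_real_mult of_real_1)
qed

text \<open>The hypothesis is Im z \<noteq> 0, here and in the composition laws, because the
  equivariant map may take values in the lower half-plane.\<close>

lemma automorphy_denom_nonzero: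
  assumes "det A = 1" "Im z \<noteq> 0"
  shows "automorphy_denom A z \<noteq> 0"
proof
  assume "automorphy_denom A z = 0"
  then have "Im (automorphy_denom A z) = 0" "Re (automorphy_denom A z) = 0" by simp_all
  then have "A $ 2 $ 1 = 0" "A $ 2 $ 2 = 0"
    using assms(2) by (auto simp: automorphy_denom_def)
  then show False using assms(1) by (simp add: det_2)
qed

lemma moebius_eqI:
  assumes "automorphy_denom A z \<noteq> 0"
    and "of_real (A $ 1 $ 1) * z + of_real (A $ 1 $ 2) = w * automorphy_denom A z"
  shows "moebius A z = w"
  using assms by (simp add: moebius_def)

lemma moebius_mult_denom:
  assumes "det A = 1" "Im z \<noteq> 0"
  shows "moebius A z * automorphy_denom A z = of_real (A $ 1 $ 1) * z + of_real (A $ 1 $ 2)"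
  using automorphy_denom_nonzero[OF assms] by (simp add: moebius_def)

text \<open>Stated for nonzero denominators instead of nonreal points: the value of the equivariant
  map may still be real where this is applied.\<close>

lemma moebius_diff:
  assumes "det A = 1" "automorphy_denom A z \<noteq> 0" "automorphy_denom A w \<noteq> 0"
  shows "moebius A z - moebius A w = (z - w) / (automorphy_denom A z * automorphy_denom A w)"
proof -
  have d: "complex_of_real (A $ 1 $ 1) * of_real (A $ 2 $ 2) - of_real (A $ 1 $ 2) * of_real (A $ 2 $ 1) = 1"
    using det2_of_real[OF assms(1)] .
  have "(complex_of_real (A $ 1 $ 1) * z + of_real (A $ 1 $ 2)) * automorphy_denom A w -
      (of_real (A $ 1 $ 1) * w + of_real (A $ 1 $ 2)) * automorphy_denom A z =
      (complex_of_real (A $ 1 $ 1) * of_real (A $ 2 $ 2) - of_real (A $ 1 $ 2) * of_real (A $ 2 $ 1)) * (z - w)"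
    by (simp add: automorphy_denom_def algebra_simps)
  also have "\<dots> = z - w" using d by simp
  finally show ?thesis
    using assms(2,3) by (simp add: moebius_def diff_frac_eq)
qed

lemma automorphy_denom_cnj: "automorphy_denom A (cnj z) = cnj (automorphy_denom A z)"
  by (simp add: automorphy_denom_def)

lemma moebius_cnj: "moebius A (cnj z) = cnj (moebius A z)"
  by (simp add: moebius_def automorphy_denom_cnj)

lemma Im_moebius:
  assumes "det A = 1" "Im z \<noteq> 0"
  shows "Im (moebius A z) = Im z / (cmod (automorphy_denom A z))\<^sup>2"
proof -
  let ?D = "automorphy_denom A z"
  have nz: "?D \<noteq> 0" using automorphy_denom_nonzero[OF assms] .
  have "2 * \<i> * of_real (Im (moebius A z)) = moebius A z - moebius A (cnj z)"
    by (simp add: moebius_cnj complex_diff_cnj complex_eq_iff)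
  also have "\<dots> = (z - cnj z) / (?D * cnj ?D)"
    using moebius_diff[OF assms(1) nz, of "cnj z"] nz by (simp add: automorphy_denom_cnj)
  also have "\<dots> = 2 * \<i> * of_real (Im z / (cmod ?D)\<^sup>2)"
    by (simp add: complex_norm_square[symmetric] complex_diff_cnj)
  finally have "complex_of_real (Im (moebius A z)) = of_real (Im z / (cmod ?D)\<^sup>2)"
    by (rule mult_left_cancel[THEN iffD1, rotated]) simp
  then show ?thesis using of_real_eq_iff by blast
qed

lemma Im_moebius_pos: "det A = 1 \<Longrightarrow> Im z > 0 \<Longrightarrow> Im (moebius A z) > 0"
  by (simp add: Im_moebius automorphy_denom_nonzero)

lemma Im_moebius_nonzero: "det A = 1 \<Longrightarrow> Im z \<noteq> 0 \<Longrightarrow> Im (moebius A z) \<noteq> 0"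
  by (simp add: Im_moebius automorphy_denom_nonzero)

lemma automorphy_denom_mult:
  assumes "det B = 1" "Im z \<noteq> 0"
  shows "automorphy_denom (A ** B) z = automorphy_denom A (moebius B z) * automorphy_denom B z"
proof -
  have "automorphy_denom A (moebius B z) * automorphy_denom B z =
      of_real (A $ 2 $ 1) * (moebius B z * automorphy_denom B z) + of_real (A $ 2 $ 2) * automorphy_denom B z"
    unfolding automorphy_denom_def[of A] by (simp add: algebra_simps)
  also have "\<dots> = automorphy_denom (A ** B) z"
    unfolding moebius_mult_denom[OF assms]
    by (simp add: automorphy_denom_def mult2_nth algebra_simps)
  finally show ?thesis by simp
qed

lemma moebius_mult:
  assumes "det A = 1" "det B = 1" "Im z \<noteq> 0"
  shows "moebius (A ** B) z = moebius A (moebius B z)"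
proof (rule moebius_eqI)
  have B: "Im (moebius B z) \<noteq> 0" using Im_moebius_nonzero[OF assms(2,3)] .
  show "automorphy_denom (A ** B) z \<noteq> 0"
    using automorphy_denom_nonzero assms by (simp add: det_mul)
  have "moebius A (moebius B z) * automorphy_denom (A ** B) z =
     (of_real (A $ 1 $ 1) * moebius B z + of_real (A $ 1 $ 2)) * automorphy_denom B z"
    unfolding automorphy_denom_mult[OF assms(2,3)] using moebius_mult_denom[OF assms(1) B]
    by (simp add: mult.assoc[symmetric])
  also have "\<dots> = of_real (A $ 1 $ 1) * (moebius B z * automorphy_denom B z) + of_real (A $ 1 $ 2) * automorphy_denom B z"
    by (simp add: algebra_simps)
  also have "\<dots> = of_real ((A ** B) $ 1 $ 1) * z + of_real ((A ** B) $ 1 $ 2)"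
    unfolding moebius_mult_denom[OF assms(2,3)]
    by (simp add: automorphy_denom_def mult2_nth algebra_simps)
  finally show "of_real ((A ** B) $ 1 $ 1) * z + of_real ((A ** B) $ 1 $ 2) =
      moebius A (moebius B z) * automorphy_denom (A ** B) z" by simp
qed

lemma moebius_mat1 [simp]: "moebius (mat 1) z = z"
  by (simp add: moebius_def automorphy_denom_def mat1_nth2)

lemma moebius_adj2:
  assumes "det A = 1" "Im z \<noteq> 0"
  shows "moebius (adj2 A) (moebius A z) = z" "moebius A (moebius (adj2 A) z) = z"
  using moebius_mult[of "adj2 A" A z] moebius_mult[of A "adj2 A" z] assms
  by (simp_all add: adj2_mult)

lemma open_upper_half_plane: "open upper_half_plane"
  by (simp add: upper_half_plane_def open_halfspace_Im_gt)

lemma moebius_has_field_derivative: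
  assumes "det A = 1" "Im z \<noteq> 0"
  shows "(moebius A has_field_derivative 1 / (automorphy_denom A z)\<^sup>2) (at z)"
proof -
  have d: "complex_of_real (A $ 1 $ 1) * of_real (A $ 2 $ 2) - of_real (A $ 1 $ 2) * of_real (A $ 2 $ 1) = 1"
    using det2_of_real[OF assms(1)] .
  let ?D = "automorphy_denom A z"
  have nz: "?D \<noteq> 0" using automorphy_denom_nonzero[OF assms] .
  have "((\<lambda>z. (of_real (A $ 1 $ 1) * z + of_real (A $ 1 $ 2)) / (of_real (A $ 2 $ 1) * z + of_real (A $ 2 $ 2)))
     has_field_derivative ((of_real (A $ 1 $ 1) * ?D - (of_real (A $ 1 $ 1) * z + of_real (A $ 1 $ 2)) * of_real (A $ 2 $ 1)) / (?D * ?D))) (at z)"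
    using nz unfolding automorphy_denom_def by (auto intro!: derivative_eq_intros)
  moreover have "of_real (A $ 1 $ 1) * ?D - (of_real (A $ 1 $ 1) * z + of_real (A $ 1 $ 2)) * of_real (A $ 2 $ 1)
     = complex_of_real (A $ 1 $ 1) * of_real (A $ 2 $ 2) - of_real (A $ 1 $ 2) * of_real (A $ 2 $ 1)"
    by (simp add: automorphy_denom_def algebra_simps)
  moreover have "moebius A = (\<lambda>z. (of_real (A $ 1 $ 1) * z + of_real (A $ 1 $ 2)) / (of_real (A $ 2 $ 1) * z + of_real (A $ 2 $ 2)))"
    by (rule ext) (simp add: moebius_def automorphy_denom_def)
  ultimately show ?thesis unfolding d by (simp add: power2_eq_square)
qed

section \<open>Discrete matrix groups whose orbits accumulate at every real number\<close>

text \<open>N is |c i + d|^2, so it grows as A i approaches the real line, and the upper row is then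
  close to u times the lower row. In this way u and the lower row control traces.\<close>

lemma moebius_ii:
  assumes "det A = 1"
  defines "N \<equiv> (A $ 2 $ 1)\<^sup>2 + (A $ 2 $ 2)\<^sup>2"
    and "u \<equiv> Re (moebius A \<i>)"
  shows "N > 0" "Im (moebius A \<i>) = 1 / N"
    "A $ 1 $ 1 = u * A $ 2 $ 1 + A $ 2 $ 2 / N" "A $ 1 $ 2 = u * A $ 2 $ 2 - A $ 2 $ 1 / N"
proof -
  have d: "A $ 1 $ 1 * A $ 2 $ 2 - A $ 1 $ 2 * A $ 2 $ 1 = 1" using assms(1) by (simp add: det_2)
  then have "A $ 2 $ 1 \<noteq> 0 \<or> A $ 2 $ 2 \<noteq> 0" by auto
  then show N: "N > 0" unfolding N_def
    by (metis add.commute add_pos_nonneg zero_le_power2 zero_less_power2)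
  have D: "(cmod (automorphy_denom A \<i>))\<^sup>2 = N"
    by (simp add: N_def automorphy_denom_def cmod_power2)
  show im: "Im (moebius A \<i>) = 1 / N"
    using Im_moebius[OF assms(1), of \<i>] by (simp add: D)
  have "moebius A \<i> * automorphy_denom A \<i> = of_real (A $ 1 $ 1) * \<i> + of_real (A $ 1 $ 2)"
    using moebius_mult_denom[OF assms(1)] by simp
  from arg_cong[OF this, of Re] arg_cong[OF this, of Im]
  show "A $ 1 $ 1 = u * A $ 2 $ 1 + A $ 2 $ 2 / N" "A $ 1 $ 2 = u * A $ 2 $ 2 - A $ 2 $ 1 / N"
    by (simp_all add: automorphy_denom_def im u_def)
qed

text \<open>If both traces \<open>tr A\<close> and \<open>tr (B A)\<close> are at most 2 in absolute value and \<open>(c, d)\<close>, the lower row of \<open>A\<close>,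
  is long, then \<open>u = Re (A \<i>)\<close> almost satisfies the fixed point equation of \<open>B = (p, q; r, s)\<close>.\<close>

lemma trace_estimate:
  fixes p q r s c d u N X :: real
  assumes N: "N = c\<^sup>2 + d\<^sup>2" "N \<ge> 1" and u: "\<bar>u\<bar> \<le> X"
    and t1: "\<bar>u * c + d / N + d\<bar> \<le> 2"
    and t2: "\<bar>p * (u * c + d / N) + q * c + r * (u * d - c / N) + s * d\<bar> \<le> 2"
  shows "\<bar>p * u + q - r * u\<^sup>2 - s * u\<bar> * (1 - 3 / sqrt N)
    \<le> (2 + \<bar>p\<bar> + \<bar>r\<bar> + 3 * (\<bar>r\<bar> * X + \<bar>s\<bar>)) * (1 + X) / sqrt N"
proof -
  define n where "n = sqrt N"
  have n: "n \<ge> 1" "n\<^sup>2 = N" using N by (auto simp: n_def)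
  have cn: "\<bar>c\<bar> \<le> n" "\<bar>d\<bar> \<le> n"
    unfolding n_def N(1) by (auto intro: real_le_rsqrt)
  have nN: "n \<le> N" using n by (metis self_le_power zero_less_numeral)
  have cN: "\<bar>c / N\<bar> \<le> 1" "\<bar>d / N\<bar> \<le> 1"
    using cn nN N(2) by (auto simp: divide_le_eq_1)
  \<comment> \<open>Up to the small term d / N this is the trace of A; hence the bound 3 = 2 +
    1.\<close>
  define e where "e = d + u * c"
  have e: "\<bar>e\<bar> \<le> 3" using t1 cN unfolding e_def by linarith
  define M where "M = 2 + \<bar>p\<bar> + \<bar>r\<bar> + 3 * (\<bar>r\<bar> * X + \<bar>s\<bar>)"
  define br where "br = p * u + q - r * u\<^sup>2 - s * u"
  have X: "X \<ge> 0" using u by linarith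
  \<comment> \<open>Put d = e - u c into the trace of B A: the terms containing c collect into
    \<open>br\<close>, and all others stay bounded.\<close>
  have b1: "c * br = (p * (u * c + d / N) + q * c + r * (u * d - c / N) + s * d)
       - p * (d / N) + r * (c / N) - (r * u + s) * e"
    unfolding br_def e_def by (simp add: algebra_simps power2_eq_square)
  have "\<bar>p * (d / N)\<bar> \<le> \<bar>p\<bar>" "\<bar>r * (c / N)\<bar> \<le> \<bar>r\<bar>"
    using cN mult_left_le[of "\<bar>d / N\<bar>" "\<bar>p\<bar>"] mult_left_le[of "\<bar>c / N\<bar>" "\<bar>r\<bar>"] by (simp_all only: abs_mult abs_ge_zero)
  moreover have "\<bar>(r * u + s) * e\<bar> \<le> (\<bar>r\<bar> * X + \<bar>s\<bar>) * 3"
  proof -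
    have "\<bar>r * u + s\<bar> \<le> \<bar>r\<bar> * X + \<bar>s\<bar>"
      using abs_triangle_ineq[of "r * u" s] mult_left_mono[OF u abs_ge_zero[of r]] by (simp add: abs_mult)
    then show ?thesis unfolding abs_mult using e by (intro mult_mono) auto
  qed
  moreover have "\<bar>t - x + y - z\<bar> \<le> 2 + x' + y' + z'"
    if "\<bar>x\<bar> \<le> x'" "\<bar>y\<bar> \<le> y'" "\<bar>z\<bar> \<le> z'" "\<bar>t\<bar> \<le> 2" for t x y z x' y' z' :: real
    using that by linarith
  ultimately have "\<bar>c * br\<bar> \<le> 2 + \<bar>p\<bar> + \<bar>r\<bar> + (\<bar>r\<bar> * X + \<bar>s\<bar>) * 3"
    using t2 unfolding b1 by blast
  then have "\<bar>c * br\<bar> \<le> M" unfolding M_def by (simp only: mult.commute)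
  then have cb: "\<bar>c\<bar> * \<bar>br\<bar> \<le> M" by (simp add: abs_mult)
  \<comment> \<open>Since d is - u c up to an error of 3, a long lower row forces c to be large.
    This is what turns the bound on c times \<open>br\<close> into one on \<open>br\<close>.\<close>
  have "\<bar>d\<bar> \<le> X * \<bar>c\<bar> + 3"
    using e mult_right_mono[OF u abs_ge_zero[of c]] abs_triangle_ineq4[of e "u * c"] unfolding e_def
    by (simp add: abs_mult)
  moreover have "n \<le> \<bar>c\<bar> + \<bar>d\<bar>"
    unfolding n_def N(1) using sqrt_sum_squares_le_sum_abs[of c d] by simp
  ultimately have "n - 3 \<le> \<bar>c\<bar> * (1 + X)" by (simp add: algebra_simps)
  then have "\<bar>br\<bar> * (n - 3) \<le> \<bar>br\<bar> * (\<bar>c\<bar> * (1 + X))"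
    by (rule mult_left_mono) simp
  also have "\<dots> = (\<bar>c\<bar> * \<bar>br\<bar>) * (1 + X)" by simp
  also have "\<dots> \<le> M * (1 + X)" using cb X by (intro mult_right_mono) auto
  finally have "\<bar>br\<bar> * (n - 3) / n \<le> M * (1 + X) / n" using n by (intro divide_right_mono) auto
  moreover have "\<bar>br\<bar> * (n - 3) / n = \<bar>br\<bar> * (1 - 3 / n)" using n by (simp add: field_simps)
  ultimately show ?thesis unfolding br_def M_def n_def by simp
qed

lemma quadratic_zero:
  fixes a b c :: real
  assumes "\<And>x. a * x\<^sup>2 + b * x + c = 0"
  shows "a = 0" "b = 0" "c = 0"
  using assms[of 0] assms[of 1] assms[of "-1"] by simp_all

text \<open>What the argument keeps of a Fuchsian group of the first kind, at the level of matrices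
  instead of cosets: \<open>finite_bounded\<close> is discreteness, and \<open>orbit_dense\<close>
  asks for accumulation of each single orbit at each real number.\<close>

locale dense_orbit_group =
  fixes G :: "(real^2^2) set"
  assumes det1: "A \<in> G \<Longrightarrow> det A = 1"
    and mult_closed: "A \<in> G \<Longrightarrow> B \<in> G \<Longrightarrow> A ** B \<in> G"
    and adj2_closed: "A \<in> G \<Longrightarrow> adj2 A \<in> G"
    and finite_bounded: "finite {A \<in> G. \<forall>i j. \<bar>A $ i $ j\<bar> \<le> R}"
    and orbit_dense: "Im w > 0 \<Longrightarrow> \<epsilon> > 0 \<Longrightarrow> \<exists>A\<in>G. cmod (moebius A w - of_real x) < \<epsilon>"
begin

lemma orbit_sequence:
  assumes "Im w > 0"
  obtains A where "\<And>n::nat. A n \<in> G" "(\<lambda>n. moebius (A n) w) \<longlonglongrightarrow> complex_of_real x"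
proof -
  have "\<exists>A\<in>G. cmod (moebius A w - of_real x) < inverse (Suc n)" for n
    using orbit_dense[OF assms, of "inverse (Suc n)"] by simp
  then obtain A where A: "\<And>n. A n \<in> G" "\<And>n. cmod (moebius (A n) w - of_real x) < inverse (Suc n)"
    by metis
  have "(\<lambda>n. moebius (A n) w - of_real x) \<longlonglongrightarrow> 0"
  proof (rule Lim_null_comparison[OF _ LIMSEQ_inverse_real_of_nat], rule eventuallyI)
    show "cmod (moebius (A n) w - of_real x) \<le> inverse (real (Suc n))" for n
      using A(2)[of n] by (rule less_imp_le)
  qed
  from that[OF A(1) LIM_zero_cancel[OF this]] show ?thesis .
qed

text \<open>Without hyperbolic elements every real number would be a fixed point of every element.\<close>

lemma exists_hyperbolic: "\<exists>A\<in>G. \<bar>A $ 1 $ 1 + A $ 2 $ 2\<bar> > 2"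
proof (rule ccontr)
  assume "\<not> ?thesis"
  then have tr: "\<bar>A $ 1 $ 1 + A $ 2 $ 2\<bar> \<le> 2" if "A \<in> G" for A using that by force
  have key: "- B $ 2 $ 1 * x\<^sup>2 + (B $ 1 $ 1 - B $ 2 $ 2) * x + B $ 1 $ 2 = 0" if B: "B \<in> G" for B x
  proof -
    obtain A where A: "\<And>n::nat. A n \<in> G" "(\<lambda>n. moebius (A n) \<i>) \<longlonglongrightarrow> complex_of_real x"
      using orbit_sequence[of \<i>] by auto
    define u where "u = (\<lambda>n. Re (moebius (A n) \<i>))"
    define v where "v = (\<lambda>n. Im (moebius (A n) \<i>))"
    have lu: "u \<longlonglongrightarrow> x" using tendsto_Re[OF A(2)] by (simp add: u_def)
    have lv: "v \<longlonglongrightarrow> 0" using tendsto_Im[OF A(2)] by (simp add: v_def)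
    obtain X where X: "\<And>n. \<bar>u n\<bar> \<le> X"
      using convergent_imp_Bseq[of u] lu unfolding Bseq_def convergent_def by auto
    define M where "M = (2 + \<bar>B $ 1 $ 1\<bar> + \<bar>B $ 2 $ 1\<bar> + 3 * (\<bar>B $ 2 $ 1\<bar> * X + \<bar>B $ 2 $ 2\<bar>)) * (1 + X)"
    define br where "br = (\<lambda>u. B $ 1 $ 1 * u + B $ 1 $ 2 - B $ 2 $ 1 * u\<^sup>2 - B $ 2 $ 2 * u)"
    have "\<forall>\<^sub>F n in sequentially. v n < 1" using lv by (rule order_tendstoD) simp
    \<comment> \<open>\<open>v n\<close> is 1 / N, so \<open>sqrt (v n)\<close> is the error 1 /
      sqrt N of the trace estimate; in the limit only \<open>br x = 0\<close> remains.\<close>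
    then have ev: "\<forall>\<^sub>F n in sequentially. \<bar>br (u n)\<bar> * (1 - 3 * sqrt (v n)) \<le> M * sqrt (v n)"
    proof eventually_elim
      case (elim n)
      let ?A = "A n"
      note f = moebius_ii[OF det1[OF A(1)[of n]], folded u_def]
      let ?N = "(?A $ 2 $ 1)\<^sup>2 + (?A $ 2 $ 2)\<^sup>2"
      have un: "Re (moebius ?A \<i>) = u n" "Im (moebius ?A \<i>) = v n" by (simp_all add: u_def v_def)
      note f = f[unfolded un]
      have N1: "?N \<ge> 1" using f(1,2) elim by (simp add: field_simps)
      have "\<bar>B $ 1 $ 1 * u n + B $ 1 $ 2 - B $ 2 $ 1 * (u n)\<^sup>2 - B $ 2 $ 2 * u n\<bar> * (1 - 3 / sqrt ?N) \<le> M / sqrt ?N"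
        unfolding M_def
      proof (rule trace_estimate[OF refl N1 X])
        show "\<bar>u n * ?A $ 2 $ 1 + ?A $ 2 $ 2 / ?N + ?A $ 2 $ 2\<bar> \<le> 2"
          using tr[OF A(1)[of n]] f(3) by simp
        have "\<bar>B $ 1 $ 1 * ?A $ 1 $ 1 + B $ 1 $ 2 * ?A $ 2 $ 1 + B $ 2 $ 1 * ?A $ 1 $ 2 + B $ 2 $ 2 * ?A $ 2 $ 2\<bar> \<le> 2"
          using tr[OF mult_closed[OF B A(1)[of n]]] by (simp add: mult2_nth add_ac)
        then show "\<bar>B $ 1 $ 1 * (u n * ?A $ 2 $ 1 + ?A $ 2 $ 2 / ?N) + B $ 1 $ 2 * ?A $ 2 $ 1 +
             B $ 2 $ 1 * (u n * ?A $ 2 $ 2 - ?A $ 2 $ 1 / ?N) + B $ 2 $ 2 * ?A $ 2 $ 2\<bar> \<le> 2"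
          unfolding f(3,4)[symmetric] .
      qed
      moreover have "sqrt (v n) = 1 / sqrt ?N" unfolding f(2) by (simp add: real_sqrt_divide)
      ultimately show ?case by (simp add: br_def)
    qed
    have "\<bar>br x\<bar> * (1 - 3 * sqrt 0) \<le> M * sqrt 0"
    proof (rule tendsto_le[OF _ _ _ ev])
      show "(\<lambda>n. M * sqrt (v n)) \<longlonglongrightarrow> M * sqrt 0" by (intro tendsto_intros lv)
      show "(\<lambda>n. \<bar>br (u n)\<bar> * (1 - 3 * sqrt (v n))) \<longlonglongrightarrow> \<bar>br x\<bar> * (1 - 3 * sqrt 0)"
        unfolding br_def by (intro tendsto_intros lv lu)
    qed simp
    then have "br x = 0" by simp
    then show ?thesis by (simp add: br_def algebra_simps)
  qed
  have triv: "moebius B \<i> = \<i>" if B: "B \<in> G" for B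
  proof -
    have q: "B $ 2 $ 1 = 0" "B $ 1 $ 1 = B $ 2 $ 2" "B $ 1 $ 2 = 0"
      using quadratic_zero[OF key[OF B]] by simp_all
    have "automorphy_denom B \<i> \<noteq> 0" using automorphy_denom_nonzero[OF det1[OF B]] by simp
    then show ?thesis using q by (intro moebius_eqI) (auto simp: automorphy_denom_def)
  qed
  \<comment> \<open>The radius 1 is the distance from \<i> to 0: an element fixing \<i> cannot
    satisfy the bound.\<close>
  obtain B where "B \<in> G" "cmod (moebius B \<i> - of_real 0) < 1"
    using orbit_dense[of \<i> 1 0] by auto
  then show False using triv[of B] by simp
qed

text \<open>Otherwise the orbit of \<open>B \<i>\<close> would stay on the geodesic \<open>B (\<i> \<real>\<^sub>>\<^sub>0)\<close>. The quadratic equation of that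
  geodesic would then hold at all real numbers.\<close>

lemma orbit_not_in_axis:
  assumes B: "det B = 1"
  shows "\<exists>A\<in>G. (let M = adj2 B ** A ** B in M $ 1 $ 1 * M $ 2 $ 1 \<noteq> 0 \<or> M $ 1 $ 2 * M $ 2 $ 2 \<noteq> 0)"
proof (rule ccontr)
  assume H: "\<not> ?thesis"
  define w where "w = moebius B \<i>"
  have w: "Im w > 0" using Im_moebius_pos[OF B, of \<i>] by (simp add: w_def)
  \<comment> \<open>\<open>Q z\<close> is the real part of (d z - b) times the conjugate of a - c z.
    In the upper half-plane it vanishes exactly when B^-1 z is purely imaginary.\<close>
  define Q where "Q = (\<lambda>z. - B $ 2 $ 1 * B $ 2 $ 2 * (cmod z)\<^sup>2
      + (B $ 1 $ 1 * B $ 2 $ 2 + B $ 1 $ 2 * B $ 2 $ 1) * Re z - B $ 1 $ 1 * B $ 1 $ 2)"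
  have Q0: "Q (moebius A w) = 0" if A: "A \<in> G" for A
  proof -
    define M where "M = adj2 B ** A ** B"
    have M: "det M = 1" using det1[OF A] B by (simp add: M_def det_mul)
    have 0: "M $ 1 $ 1 * M $ 2 $ 1 = 0" "M $ 1 $ 2 * M $ 2 $ 2 = 0"
      using H A unfolding M_def Let_def by auto
    have dM: "M $ 1 $ 1 * M $ 2 $ 2 - M $ 1 $ 2 * M $ 2 $ 1 = 1" using M by (simp add: det_2)
    define v where "v = moebius M \<i>"
    have v: "Im v > 0" using Im_moebius_pos[OF M, of \<i>] by (simp add: v_def)
    have "Re v = 0"
    proof -
      have "automorphy_denom M \<i> \<noteq> 0" using automorphy_denom_nonzero[OF M] by simp
      then have "cmod (automorphy_denom M \<i>) \<noteq> 0" by simp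
      then have "(M $ 2 $ 2)\<^sup>2 + (M $ 2 $ 1)\<^sup>2 \<noteq> 0" by (simp add: cmod_def automorphy_denom_def)
      then show ?thesis
        using 0 by (auto simp: v_def moebius_def automorphy_denom_def Re_divide)
    qed
    have "B ** M = A ** B"
      unfolding M_def using adj2_mult(2)[OF B] by (simp add: matrix_mul_assoc)
    then have eq: "moebius A w = moebius B v"
      using moebius_mult[OF B M, of \<i>] moebius_mult[OF det1[OF A] B, of \<i>]
      by (simp add: v_def w_def)
    define z where "z = moebius B v"
    have z: "Im z > 0" using Im_moebius_pos[OF B v] by (simp add: z_def)
    have "moebius (adj2 B) z = v" using moebius_adj2(1)[OF B] v by (simp add: z_def)
    then have "v * automorphy_denom (adj2 B) z = of_real (adj2 B $ 1 $ 1) * z + of_real (adj2 B $ 1 $ 2)"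
      using moebius_mult_denom[of "adj2 B" z] B z by simp
    then have e: "v * (of_real (B $ 1 $ 1) - of_real (B $ 2 $ 1) * z) = of_real (B $ 2 $ 2) * z - of_real (B $ 1 $ 2)"
      by (simp add: automorphy_denom_def algebra_simps)
    let ?a = "B $ 1 $ 1" and ?b = "B $ 1 $ 2" and ?c = "B $ 2 $ 1" and ?d = "B $ 2 $ 2"
    define x y where "x = Re z" and "y = Im z"
    have e1: "?d * x - ?b = Im v * ?c * y" and e2: "?d * y = Im v * (?a - ?c * x)"
      using arg_cong[OF e, of Re] arg_cong[OF e, of Im] \<open>Re v = 0\<close> by (simp_all add: x_def y_def)
    have "(?d * x - ?b) * (?a - ?c * x) = ?c * y * (?d * y)"
      unfolding e1 e2 by simp
    moreover have "Q z = - ?c * ?d * (x\<^sup>2 + y\<^sup>2) + (?a * ?d + ?b * ?c) * x - ?a * ?b"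
      by (simp only: Q_def cmod_power2 x_def y_def)
    ultimately have "Q z = 0" by (simp add: algebra_simps power2_eq_square)
    then show ?thesis using eq by (simp add: z_def)
  qed
  have Qx: "Q (of_real x) = 0" for x
  proof -
    obtain A where A: "\<And>n::nat. A n \<in> G" "(\<lambda>n. moebius (A n) w) \<longlonglongrightarrow> complex_of_real x"
      using orbit_sequence[OF w] by auto
    have "(\<lambda>n. Q (moebius (A n) w)) \<longlonglongrightarrow> Q (of_real x)"
      unfolding Q_def by (intro tendsto_intros A(2))
    then show ?thesis using Q0[OF A(1)] by (simp add: LIMSEQ_const_iff)
  qed
  have "(- B $ 2 $ 1 * B $ 2 $ 2) * x\<^sup>2 + (B $ 1 $ 1 * B $ 2 $ 2 + B $ 1 $ 2 * B $ 2 $ 1) * x + (- B $ 1 $ 1 * B $ 1 $ 2) = 0" for x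
    using Qx[of x] by (simp add: Q_def)
  from quadratic_zero[OF this]
  have "B $ 2 $ 1 * B $ 2 $ 2 = 0" "B $ 1 $ 1 * B $ 2 $ 2 + B $ 1 $ 2 * B $ 2 $ 1 = 0" by auto
  moreover have "B $ 1 $ 1 * B $ 2 $ 2 - B $ 1 $ 2 * B $ 2 $ 1 = 1" using B by (simp add: det_2)
  \<comment> \<open>The last two equations give a d = 1/2 and b c = -1/2, so c and d are nonzero,
    against c d = 0.\<close>
  ultimately show False by (auto simp: mult_eq_0_iff)
qed

end

section \<open>Diagonal form of hyperbolic elements\<close>

lemma hyperbolic_diagonalisable:
  fixes A :: "real^2^2"
  assumes A: "det A = 1" and tr: "\<bar>A $ 1 $ 1 + A $ 2 $ 2\<bar> > 2"
  obtains B m where "det B = 1" "m \<noteq> 0" "m\<^sup>2 \<noteq> 1" "A ** B = B ** mat2 m 0 0 (1 / m)"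
proof -
  define a b c d where "a = A $ 1 $ 1" and "b = A $ 1 $ 2" and "c = A $ 2 $ 1" and "d = A $ 2 $ 2"
  note abcd = a_def[symmetric] b_def[symmetric] c_def[symmetric] d_def[symmetric]
  have dt: "a * d - b * c = 1" using A by (simp add: det_2 abcd)
  define t where "t = a + d"
  have t2: "t\<^sup>2 > 4" using tr power_strict_mono[of 2 "\<bar>t\<bar>" 2] by (simp add: t_def abcd)
  define s where "s = sqrt (t\<^sup>2 - 4)"
  have s: "s > 0" "s\<^sup>2 = t\<^sup>2 - 4" using t2 by (auto simp: s_def)
  define m m' where "m = (t + s) / 2" and "m' = (t - s) / 2"
  have mm: "m * m' = 1" using s(2) by (simp add: m_def m'_def field_simps power2_eq_square)
  have ms: "m + m' = a + d" by (simp add: m_def m'_def t_def field_simps)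
  have ne: "m \<noteq> m'" using s(1) by (simp add: m_def m'_def)
  have m0: "m \<noteq> 0" using mm by auto
  have m': "m' = 1 / m" using mm m0 by (simp add: field_simps)
  have m1: "m\<^sup>2 \<noteq> 1" using ne mm m0 by (metis mult_left_cancel power2_eq_square)
  have r1: "m * (m - d) = a * (m - d) + b * c"
  proof -
    have "m * (m - d) = m * (a - m')" using ms by (metis add_diff_cancel_left' add_diff_eq diff_diff_eq2 diff_eq_eq)
    also have "\<dots> = a * m - 1" using mm by (simp add: algebra_simps)
    finally show ?thesis using dt by (simp add: algebra_simps)
  qed
  have r2: "m' * (m' - d) = a * (m' - d) + b * c"
  proof -
    have "m' * (m' - d) = m' * (a - m)" using ms by (metis add.commute add_diff_cancel_left' add_diff_eq diff_diff_eq2 diff_eq_eq)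
    also have "\<dots> = a * m' - 1" using mm by (simp add: algebra_simps)
    finally show ?thesis using dt by (simp add: algebra_simps)
  qed
  have r3: "m * (m - a) = d * (m - a) + b * c" "m' * (m' - a) = d * (m' - a) + b * c"
    using r1 r2 by (simp_all add: algebra_simps)
  show ?thesis
  proof (cases "c = 0")
    case False
    \<comment> \<open>The columns of the witness are eigenvectors for m and 1 / m; k scales the
      first one so that the determinant is 1.\<close>
    define k where "k = 1 / (c * (m - m'))"
    have k: "k * c * (m - m') = 1" using False ne by (simp add: k_def)
    show ?thesis
    proof (rule that[OF _ m0 m1])
      show "det (mat2 ((m - d) * k) (m' - d) (c * k) c) = 1"
        using k by (simp add: det_2 algebra_simps)
      have "a * (m - d) * k + b * (c * k) = m * ((m - d) * k)"
        using arg_cong[OF r1, of "\<lambda>x. x * k"] by (simp add: algebra_simps)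
      then show "A ** mat2 ((m - d) * k) (m' - d) (c * k) c = mat2 ((m - d) * k) (m' - d) (c * k) c ** mat2 m 0 0 (1 / m)"
        using r2 unfolding m'[symmetric]
        by (intro mat2_eqI) (simp_all add: mult2_nth abcd algebra_simps)
    qed
  next
    case c: True
    show ?thesis
    proof (cases "b = 0")
      case False
      define k where "k = 1 / (b * (m' - m))"
      have k: "k * b * (m' - m) = 1" using False ne by (simp add: k_def)
      show ?thesis
      proof (rule that[OF _ m0 m1])
        show "det (mat2 (b * k) b ((m - a) * k) (m' - a)) = 1"
          using k by (simp add: det_2 algebra_simps)
        have "d * (m - a) * k = m * ((m - a) * k)"
          using arg_cong[OF r3(1), of "\<lambda>x. x * k"] c by (simp add: algebra_simps)
        then show "A ** mat2 (b * k) b ((m - a) * k) (m' - a) = mat2 (b * k) b ((m - a) * k) (m' - a) ** mat2 m 0 0 (1 / m)"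
          using r3 c unfolding m'[symmetric]
          by (intro mat2_eqI) (simp_all add: mult2_nth abcd algebra_simps)
      qed
    next
      case b: True
      have ad: "a * d = 1" using dt b by simp
      then have a0: "a \<noteq> 0" by auto
      with ad have d: "d = 1 / a" by (simp add: nonzero_eq_divide_eq mult.commute)
      have a1: "a\<^sup>2 \<noteq> 1"
        using ad tr by (auto simp: power2_eq_1_iff abcd)
      show ?thesis
        by (rule that[OF _ a0 a1, of "mat 1"])
           (use b c d a0 in \<open>auto intro!: mat2_eqI simp: mult2_nth mat1_nth2 abcd det_I\<close>)
    qed
  qed
qed

lemma conj_mult:
  assumes "det B = 1"
  shows "adj2 B ** (X ** Y) ** B = (adj2 B ** X ** B) ** (adj2 B ** Y ** B)"
proof -
  have "(adj2 B ** X ** B) ** (adj2 B ** Y ** B) = adj2 B ** X ** (B ** adj2 B) ** Y ** B"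
    by (simp add: matrix_mul_assoc)
  then show ?thesis using adj2_mult(2)[OF assms] by (simp add: matrix_mul_assoc)
qed

lemma conj_conj:
  assumes "det B = 1"
  shows "B ** (adj2 B ** X ** B) ** adj2 B = X"
proof -
  have "B ** (adj2 B ** X ** B) ** adj2 B = (B ** adj2 B) ** X ** (B ** adj2 B)"
    by (simp add: matrix_mul_assoc)
  then show ?thesis using adj2_mult(2)[OF assms] by simp
qed

lemma adj2_conj: "adj2 (adj2 B ** A ** B) = adj2 B ** adj2 A ** B"
  by (rule mat2_eqI) (simp_all add: mult2_nth algebra_simps)

lemma conj_diag:
  assumes "det B = 1" "A ** B = B ** D"
  shows "adj2 B ** A ** B = D"
proof -
  have "adj2 B ** A ** B = adj2 B ** (A ** B)" by (simp add: matrix_mul_assoc)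
  also have "\<dots> = (adj2 B ** B) ** D" unfolding assms(2) by (simp add: matrix_mul_assoc)
  finally show ?thesis using adj2_mult(1)[OF assms(1)] by simp
qed

lemma abs_entry_le_norm: "\<bar>A $ i $ j\<bar> \<le> norm (A :: real^2^2)"
  using component_le_norm_cart[of "A $ i" j] Finite_Cartesian_Product.norm_nth_le[of A i] by linarith

section \<open>Common fixed points, the orbit of infinity, and proper discontinuity\<close>

context dense_orbit_group
begin

text \<open>The witness is A0^n A A0^-n: in the eigenbasis of A0 each conjugation keeps the diagonal
  and scales the two off-diagonal entries in opposite directions.\<close>

lemma conj_power:
  assumes B: "det B = 1" and A0: "A0 \<in> G" and m: "m \<noteq> 0" "adj2 B ** A0 ** B = mat2 m 0 0 (1 / m)"
    and A: "A \<in> G"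
  defines "M \<equiv> adj2 B ** A ** B"
  shows "\<exists>A'\<in>G. adj2 B ** A' ** B = mat2 (M $ 1 $ 1) (m ^ (2 * n) * M $ 1 $ 2) (M $ 2 $ 1 / m ^ (2 * n)) (M $ 2 $ 2)"
proof (induction n)
  case 0
  show ?case using A by (intro bexI[of _ A]) (auto intro!: mat2_eqI simp: M_def)
next
  case (Suc n)
  then obtain A' where A': "A' \<in> G"
    "adj2 B ** A' ** B = mat2 (M $ 1 $ 1) (m ^ (2 * n) * M $ 1 $ 2) (M $ 2 $ 1 / m ^ (2 * n)) (M $ 2 $ 2)"
    by blast
  have i: "adj2 B ** adj2 A0 ** B = mat2 (1 / m) 0 0 m"
    unfolding adj2_conj[symmetric] m(2) by (rule mat2_eqI) simp_all
  have "adj2 B ** (A0 ** A' ** adj2 A0) ** B = mat2 (M $ 1 $ 1) (m ^ (2 * Suc n) * M $ 1 $ 2) (M $ 2 $ 1 / m ^ (2 * Suc n)) (M $ 2 $ 2)"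
    unfolding conj_mult[OF B] A'(2) m(2) i
    by (rule mat2_eqI) (use m(1) in \<open>simp_all add: mult2_nth\<close>)
  then show ?case using A0 A'(1) mult_closed adj2_closed by blast
qed

text \<open>Conjugation by powers of a diagonal matrix shrinks the off-diagonal entry to 0, against discreteness.\<close>

lemma upper_triangular_imp_diagonal:
  assumes B: "det B = 1" and A0: "A0 \<in> G" and m: "m \<noteq> 0" "m\<^sup>2 \<noteq> 1" "adj2 B ** A0 ** B = mat2 m 0 0 (1 / m)"
    and A: "A \<in> G" and up: "(adj2 B ** A ** B) $ 2 $ 1 = 0"
  shows "(adj2 B ** A ** B) $ 1 $ 2 = 0"
proof (rule ccontr)
  define M where "M = adj2 B ** A ** B"
  assume "\<not> ?thesis"
  then have M12: "M $ 1 $ 2 \<noteq> 0" by (simp add: M_def)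
  have M21: "M $ 2 $ 1 = 0" using up by (simp add: M_def)
  \<comment> \<open>Replacing A0 by its inverse if necessary makes the scaling contract.\<close>
  obtain A1 \<mu> where A1: "A1 \<in> G" "adj2 B ** A1 ** B = mat2 \<mu> 0 0 (1 / \<mu>)" and \<mu>: "\<mu> \<noteq> 0" "\<bar>\<mu>\<bar> < 1"
  proof (cases "\<bar>m\<bar> < 1")
    case True
    then show ?thesis using that A0 m by blast
  next
    case False
    then have "\<bar>m\<bar> > 1" using m(2) by (metis abs_1 abs_square_eq_1 linorder_neqE_linordered_idom)
    moreover have "adj2 B ** adj2 A0 ** B = mat2 (1 / m) 0 0 (1 / (1 / m))"
      unfolding adj2_conj[symmetric] m(3) by (rule mat2_eqI) simp_all
    ultimately show ?thesis using that[of "adj2 A0" "1 / m"] adj2_closed[OF A0] m(1) by simp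
  qed
  have "\<exists>A'\<in>G. adj2 B ** A' ** B = mat2 (M $ 1 $ 1) (\<mu> ^ (2 * n) * M $ 1 $ 2) 0 (M $ 2 $ 2)" for n
    using conj_power[OF B A1(1) \<mu>(1) A1(2) A, of n] M21 by (simp add: M_def)
  then obtain A' where A': "\<And>n. A' n \<in> G"
    "\<And>n. adj2 B ** A' n ** B = mat2 (M $ 1 $ 1) (\<mu> ^ (2 * n) * M $ 1 $ 2) 0 (M $ 2 $ 2)"
    by metis
  have inj: "inj A'"
  proof (rule linorder_injI)
    fix i j :: nat assume ij: "i < j"
    have "(\<mu>\<^sup>2) ^ j < (\<mu>\<^sup>2) ^ i"
      using \<mu> ij by (intro power_strict_decreasing) (auto simp: abs_square_less_1)
    then have "\<mu> ^ (2 * i) * M $ 1 $ 2 \<noteq> \<mu> ^ (2 * j) * M $ 1 $ 2" using M12 by (simp add: power_mult)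
    then have "adj2 B ** A' i ** B \<noteq> adj2 B ** A' j ** B"
      unfolding A'(2) by (metis mat2_nth(2))
    then show "A' i \<noteq> A' j" by auto
  qed
  \<comment> \<open>\<open>A' n\<close> equals P + \<mu>^(2n) Q, so infinitely many distinct
    elements of G have bounded entries.\<close>
  define P where "P = B ** mat2 (M $ 1 $ 1) 0 0 (M $ 2 $ 2) ** adj2 B"
  define Q where "Q = B ** mat2 0 (M $ 1 $ 2) 0 0 ** adj2 B"
  have "\<bar>A' n $ i $ j\<bar> \<le> norm P + norm Q" for n i j
  proof -
    have "A' n = B ** (adj2 B ** A' n ** B) ** adj2 B" using conj_conj[OF B] by simp
    also have "\<dots> $ i $ j = P $ i $ j + \<mu> ^ (2 * n) * Q $ i $ j"
      unfolding A'(2) P_def Q_def by (simp add: mult2_nth algebra_simps)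
    finally have "\<bar>A' n $ i $ j\<bar> \<le> \<bar>P $ i $ j\<bar> + \<bar>\<mu> ^ (2 * n)\<bar> * \<bar>Q $ i $ j\<bar>"
      by (metis abs_mult abs_triangle_ineq)
    also have "\<dots> \<le> \<bar>P $ i $ j\<bar> + 1 * \<bar>Q $ i $ j\<bar>"
      using \<mu> by (intro add_left_mono mult_right_mono) (auto simp: power_abs power_le_one)
    also have "\<dots> \<le> norm P + norm Q" using abs_entry_le_norm[of P i j] abs_entry_le_norm[of Q i j] by simp
    finally show ?thesis .
  qed
  then have "range A' \<subseteq> {A \<in> G. \<forall>i j. \<bar>A $ i $ j\<bar> \<le> norm P + norm Q}" using A'(1) by auto
  then have "finite (range A')" using finite_bounded finite_subset by blast
  then show False using finite_imageD[OF _ inj] by simp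
qed

text \<open>The quarter turn in \<open>B'\<close> exchanges the two ends of the axis. It swaps m
  with 1 / m and the off-diagonal entries up to sign, which reduces this to the upper triangular
  case.\<close>

lemma lower_triangular_imp_diagonal:
  assumes B: "det B = 1" and A0: "A0 \<in> G" and m: "m \<noteq> 0" "m\<^sup>2 \<noteq> 1" "adj2 B ** A0 ** B = mat2 m 0 0 (1 / m)"
    and A: "A \<in> G" and low: "(adj2 B ** A ** B) $ 1 $ 2 = 0"
  shows "(adj2 B ** A ** B) $ 2 $ 1 = 0"
proof -
  define B' where "B' = B ** mat2 0 (-1) 1 0"
  have "det (mat2 0 (-1) 1 0) = 1" by (simp add: det_2)
  then have B': "det B' = 1" using B by (simp add: B'_def det_mul)
  have sw: "adj2 B' ** X ** B' = (let M = adj2 B ** X ** B in mat2 (M $ 2 $ 2) (- M $ 2 $ 1) (- M $ 1 $ 2) (M $ 1 $ 1))" for X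
    unfolding B'_def Let_def by (rule mat2_eqI) (simp_all add: mult2_nth algebra_simps)
  have "adj2 B' ** A0 ** B' = mat2 (1 / m) 0 0 (1 / (1 / m))"
    unfolding sw m(3) by (simp add: Let_def)
  moreover have "(1 / m)\<^sup>2 \<noteq> 1" using m by (simp add: power_divide)
  ultimately have "(adj2 B' ** A ** B') $ 1 $ 2 = 0"
    using upper_triangular_imp_diagonal[OF B' A0, of "1 / m" A] m A low by (simp add: sw Let_def)
  then show ?thesis by (simp add: sw Let_def)
qed

text \<open>The vector (x, y) stands for the boundary point x / y, with (1, 0) for \<infinity>. A
  common eigenvector of G would be an eigenvector of a hyperbolic element; in its eigenbasis all of
  G is then triangular, hence diagonal by discreteness, and would preserve its axis.\<close>

lemma no_common_eigenvector:
  assumes "x \<noteq> 0 \<or> y \<noteq> 0"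
  shows "\<exists>A\<in>G. (A $ 1 $ 1 * x + A $ 1 $ 2 * y) * y \<noteq> (A $ 2 $ 1 * x + A $ 2 $ 2 * y) * x"
proof (rule ccontr)
  assume "\<not> ?thesis"
  then have ev: "(A $ 1 $ 1 * x + A $ 1 $ 2 * y) * y = (A $ 2 $ 1 * x + A $ 2 $ 2 * y) * x" if "A \<in> G" for A
    using that by blast
  obtain A0 where A0: "A0 \<in> G" "\<bar>A0 $ 1 $ 1 + A0 $ 2 $ 2\<bar> > 2" using exists_hyperbolic by blast
  obtain B m where B: "det B = 1" and m: "m \<noteq> 0" "m\<^sup>2 \<noteq> 1" and AB: "A0 ** B = B ** mat2 m 0 0 (1 / m)"
    using hyperbolic_diagonalisable[OF det1[OF A0(1)] A0(2)] by blast
  have D: "adj2 B ** A0 ** B = mat2 m 0 0 (1 / m)" using conj_diag[OF B AB] .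
  \<comment> \<open>Coordinates of (x, y) in the eigenbasis formed by the columns of B.\<close>
  define \<xi> \<eta> where "\<xi> = B $ 2 $ 2 * x - B $ 1 $ 2 * y" and "\<eta> = B $ 1 $ 1 * y - B $ 2 $ 1 * x"
  have dB: "B $ 1 $ 1 * B $ 2 $ 2 - B $ 1 $ 2 * B $ 2 $ 1 = 1" using B by (simp add: det_2)
  have xy: "x = B $ 1 $ 1 * \<xi> + B $ 1 $ 2 * \<eta>" "y = B $ 2 $ 1 * \<xi> + B $ 2 $ 2 * \<eta>"
  proof -
    have "B $ 1 $ 1 * \<xi> + B $ 1 $ 2 * \<eta> = (B $ 1 $ 1 * B $ 2 $ 2 - B $ 1 $ 2 * B $ 2 $ 1) * x"
      "B $ 2 $ 1 * \<xi> + B $ 2 $ 2 * \<eta> = (B $ 1 $ 1 * B $ 2 $ 2 - B $ 1 $ 2 * B $ 2 $ 1) * y"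
      by (simp_all add: \<xi>_def \<eta>_def algebra_simps)
    then show "x = B $ 1 $ 1 * \<xi> + B $ 1 $ 2 * \<eta>" "y = B $ 2 $ 1 * \<xi> + B $ 2 $ 2 * \<eta>"
      unfolding dB by simp_all
  qed
  have nz: "\<xi> \<noteq> 0 \<or> \<eta> \<noteq> 0" using assms xy by auto
  have ev': "(M $ 1 $ 1 * \<xi> + M $ 1 $ 2 * \<eta>) * \<eta> = (M $ 2 $ 1 * \<xi> + M $ 2 $ 2 * \<eta>) * \<xi>"
    if A: "A \<in> G" and M: "M = adj2 B ** A ** B" for A M
  proof -
    have *: "M $ 1 $ 1 * \<xi> + M $ 1 $ 2 * \<eta> = B $ 2 $ 2 * (A $ 1 $ 1 * x + A $ 1 $ 2 * y) - B $ 1 $ 2 * (A $ 2 $ 1 * x + A $ 2 $ 2 * y)"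
      "M $ 2 $ 1 * \<xi> + M $ 2 $ 2 * \<eta> = B $ 1 $ 1 * (A $ 2 $ 1 * x + A $ 2 $ 2 * y) - B $ 2 $ 1 * (A $ 1 $ 1 * x + A $ 1 $ 2 * y)"
      unfolding xy M by (simp_all add: mult2_nth algebra_simps)
    define p q where "p = A $ 1 $ 1 * x + A $ 1 $ 2 * y" and "q = A $ 2 $ 1 * x + A $ 2 $ 2 * y"
    have pq: "p * y = q * x" using ev[OF A] by (simp add: p_def q_def)
    have "(B $ 2 $ 2 * p - B $ 1 $ 2 * q) * \<eta> - (B $ 1 $ 1 * q - B $ 2 $ 1 * p) * \<xi>
      = (B $ 1 $ 1 * B $ 2 $ 2 - B $ 1 $ 2 * B $ 2 $ 1) * (p * y - q * x)"
      by (simp add: \<xi>_def \<eta>_def algebra_simps)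
    then show ?thesis unfolding * p_def[symmetric] q_def[symmetric] using pq by simp
  qed
  have "m * \<xi> * \<eta> = (1 / m) * \<eta> * \<xi>" using ev'[OF A0(1) D[symmetric]] by simp
  then have "(m\<^sup>2 - 1) * (\<xi> * \<eta>) = 0" using m(1) by (simp add: field_simps power2_eq_square)
  then have "\<xi> * \<eta> = 0" using m(2) by simp
  have off: "(adj2 B ** A ** B) $ 1 $ 2 = 0 \<and> (adj2 B ** A ** B) $ 2 $ 1 = 0" if A: "A \<in> G" for A
  proof (cases "\<eta> = 0")
    case True
    then have "(adj2 B ** A ** B) $ 2 $ 1 = 0" using ev'[OF A refl] nz by simp
    then show ?thesis using upper_triangular_imp_diagonal[OF B A0(1) m D A] by simp
  next
    case False
    then have "\<xi> = 0" using \<open>\<xi> * \<eta> = 0\<close> by simp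
    then have "(adj2 B ** A ** B) $ 1 $ 2 = 0" using ev'[OF A refl] False by simp
    then show ?thesis using lower_triangular_imp_diagonal[OF B A0(1) m D A] by simp
  qed
  then show False using orbit_not_in_axis[OF B] by (auto simp: Let_def)
qed

text \<open>If \<open>A \<i>\<close> is close to \<open>x\<close>, then so is at least one of \<open>A \<infinity>\<close> and \<open>A B \<infinity>\<close>, for a fixed \<open>B\<close> that moves \<open>\<infinity>\<close>.\<close>

lemma cusp_orbit_dense:
  assumes "\<epsilon> > 0"
  shows "\<exists>A\<in>G. A $ 2 $ 1 \<noteq> 0 \<and> \<bar>A $ 1 $ 1 / A $ 2 $ 1 - x\<bar> < \<epsilon>"
proof -
  obtain B where B: "B \<in> G" "B $ 2 $ 1 \<noteq> 0" using no_common_eigenvector[of 1 0] by auto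
  define p r where "p = B $ 1 $ 1" and "r = B $ 2 $ 1"
  have r: "r \<noteq> 0" using B by (simp add: r_def)
  \<comment> \<open>L is chosen to give n \<le> y L below, and L' to give |w| L \<le> n L' for both
    numerators w that occur, d and d p - c r.\<close>
  define L where "L = 1 + (1 + \<bar>p\<bar>) / \<bar>r\<bar>"
  define L' where "L' = L * (1 + \<bar>p\<bar> + \<bar>r\<bar>)"
  have L: "L \<ge> 1" by (simp add: L_def)
  have L': "L' \<ge> L" "L' * 1 \<ge> L * (\<bar>p\<bar> + \<bar>r\<bar>)" unfolding L'_def using L by (auto simp: algebra_simps)
  define \<delta> where "\<delta> = \<epsilon> / (1 + L')"
  have \<delta>: "\<delta> > 0" "\<delta> * (1 + L') = \<epsilon>" using assms L L' by (auto simp: \<delta>_def)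
  obtain A where A: "A \<in> G" "cmod (moebius A \<i> - of_real x) < \<delta>"
    using orbit_dense[of \<i> \<delta> x] \<delta> by auto
  define u v where "u = Re (moebius A \<i>)" and "v = Im (moebius A \<i>)"
  define c d N where "c = A $ 2 $ 1" and "d = A $ 2 $ 2" and "N = c\<^sup>2 + d\<^sup>2"
  note f = moebius_ii[OF det1[OF A(1)], folded c_def d_def N_def u_def v_def]
  define n where "n = sqrt N"
  have n: "n > 0" "n * n = N" using f(1) by (auto simp: n_def)
  have u: "\<bar>u - x\<bar> < \<delta>" using A(2) abs_Re_le_cmod[of "moebius A \<i> - of_real x"] by (simp add: u_def)
  have v: "v < \<delta>" using A(2) abs_Im_le_cmod[of "moebius A \<i> - of_real x"] by (simp add: v_def)
  have cn: "\<bar>c\<bar> \<le> n" "\<bar>d\<bar> \<le> n" unfolding n_def N_def by (auto intro: real_le_rsqrt)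
  have ncd: "n \<le> \<bar>c\<bar> + \<bar>d\<bar>"
    unfolding n_def N_def using sqrt_sum_squares_le_sum_abs[of c d] by simp
  \<comment> \<open>This is the lower left entry of A B. As r \<noteq> 0, c and e determine d, so
    they cannot both be small compared with the length n of the lower row of A.\<close>
  define e where "e = c * p + d * r"
  define y where "y = max \<bar>c\<bar> \<bar>e\<bar>"
  have "\<bar>d\<bar> * \<bar>r\<bar> \<le> y * (1 + \<bar>p\<bar>)"
  proof -
    have "d * r = e - c * p" by (simp add: e_def)
    then have "\<bar>d\<bar> * \<bar>r\<bar> \<le> \<bar>e\<bar> + \<bar>c\<bar> * \<bar>p\<bar>" by (metis abs_mult abs_triangle_ineq4)
    also have "\<dots> \<le> y + y * \<bar>p\<bar>" unfolding y_def by (intro add_mono mult_right_mono) auto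
    finally show ?thesis by (simp add: algebra_simps)
  qed
  then have "\<bar>d\<bar> \<le> y * (1 + \<bar>p\<bar>) / \<bar>r\<bar>" using r by (simp add: field_simps)
  moreover have "\<bar>c\<bar> \<le> y" by (simp add: y_def)
  ultimately have nL: "n \<le> y * L" using ncd by (simp add: L_def algebra_simps add_divide_distrib)
  then have "y * L > 0" using n(1) by linarith
  then have y: "y > 0" using L by (simp add: zero_less_mult_iff)
  have est: "\<bar>w / (N * y)\<bar> \<le> L' * v" if w: "\<bar>w\<bar> * L \<le> n * L'" for w
  proof -
    have "\<bar>w\<bar> * n \<le> \<bar>w\<bar> * (y * L)" using nL by (intro mult_left_mono) auto
    also have "\<dots> \<le> n * L' * y" using mult_right_mono[OF w, of y] y by (simp add: algebra_simps)
    finally have "\<bar>w\<bar> \<le> L' * y" using n(1) by (simp add: algebra_simps)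
    then show ?thesis using f(1) y by (simp add: f(2) abs_mult field_simps)
  qed
  have fin: "\<bar>z - x\<bar> < \<epsilon>" if "\<bar>z - u\<bar> \<le> L' * v" for z
  proof -
    have "L' * v \<le> L' * \<delta>" using v L L' by (intro mult_left_mono) auto
    then show ?thesis using that u \<delta>(2) by (simp add: algebra_simps)
  qed
  show ?thesis
  proof (cases "\<bar>c\<bar> = y")
    case True
    then have c0: "c \<noteq> 0" using y by auto
    have "A $ 1 $ 1 / c - u = d / (N * c)" unfolding f(3) using f(1) c0 by (simp add: field_simps)
    moreover have "\<bar>d\<bar> * L \<le> n * L'" using cn(2) L' L by (intro mult_mono) auto
    then have "\<bar>d / (N * y)\<bar> \<le> L' * v" by (rule est)
    ultimately have "\<bar>A $ 1 $ 1 / c - u\<bar> \<le> L' * v" using True y by (simp add: abs_mult)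
    then show ?thesis using A(1) c0 fin by (intro bexI[of _ A]) (auto simp: c_def)
  next
    case False
    then have e: "\<bar>e\<bar> = y" by (auto simp: y_def max_def split: if_splits)
    then have e0: "e \<noteq> 0" using y by auto
    have E: "(A ** B) $ 2 $ 1 = e" by (simp add: mult2_nth e_def c_def d_def p_def r_def)
    have "(A ** B) $ 1 $ 1 = A $ 1 $ 1 * p + A $ 1 $ 2 * r" by (simp add: mult2_nth p_def r_def)
    also have "\<dots> = u * e + (d * p - c * r) / N"
      unfolding f(3,4) e_def by (simp add: algebra_simps diff_divide_distrib)
    finally have AB: "(A ** B) $ 1 $ 1 = u * e + (d * p - c * r) / N" .
    have "(A ** B) $ 1 $ 1 / e - u = (d * p - c * r) / (N * e)" unfolding AB using e0 f(1) by (simp add: field_simps)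
    moreover have "\<bar>d * p - c * r\<bar> * L \<le> n * L'"
    proof -
      have "\<bar>d * p - c * r\<bar> \<le> \<bar>d\<bar> * \<bar>p\<bar> + \<bar>c\<bar> * \<bar>r\<bar>" by (metis abs_mult abs_triangle_ineq4)
      also have "\<dots> \<le> n * \<bar>p\<bar> + n * \<bar>r\<bar>" using cn by (intro add_mono mult_right_mono) auto
      finally have "\<bar>d * p - c * r\<bar> * L \<le> (n * \<bar>p\<bar> + n * \<bar>r\<bar>) * L" using L by (intro mult_right_mono) auto
      also have "\<dots> = n * (L * (\<bar>p\<bar> + \<bar>r\<bar>))" by (simp add: algebra_simps)
      also have "\<dots> \<le> n * L'" using n(1) L'(2) by (intro mult_left_mono) auto
      finally show ?thesis .
    qed
    then have "\<bar>(d * p - c * r) / (N * y)\<bar> \<le> L' * v" by (rule est)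
    ultimately have "\<bar>(A ** B) $ 1 $ 1 / e - u\<bar> \<le> L' * v" using e y by (simp add: abs_mult)
    then show ?thesis using mult_closed[OF A(1) B(1)] e0 fin E by (intro bexI[of _ "A ** B"]) auto
  qed
qed

text \<open>Proper discontinuity. If z and A z stay in K, then |c z + d|^2 = Im z / Im (A z) is
  bounded, which bounds c and d; the equation A z (c z + d) = a z + b then bounds a and b.\<close>

lemma finite_return:
  assumes K: "compact K" "K \<subseteq> upper_half_plane"
  shows "finite {A \<in> G. \<exists>z\<in>K. moebius A z \<in> K}"
proof (cases "K = {}")
  case False
  have "\<exists>z0\<in>K. \<forall>z\<in>K. Im z0 \<le> Im z"
    by (rule continuous_attains_inf[OF K(1) False]) (intro continuous_intros)
  then obtain z0 where z0: "z0 \<in> K" "\<And>z. z \<in> K \<Longrightarrow> Im z0 \<le> Im z" by blast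
  define m where "m = Im z0"
  have m: "m > 0" "\<And>z. z \<in> K \<Longrightarrow> m \<le> Im z" using z0 K(2) by (auto simp: m_def upper_half_plane_def)
  obtain R where R: "R > 0" "\<And>z. z \<in> K \<Longrightarrow> cmod z \<le> R"
    using compact_imp_bounded[OF K(1)] by (auto simp: bounded_pos)
  define S where "S = sqrt (R / m)"
  define T where "T = max (S / m) (S + S / m * R) + max (R * S / m) (R * S + R * S / m * R)"
  have "\<bar>A $ i $ j\<bar> \<le> T" if A: "A \<in> G" and z: "z \<in> K" "moebius A z \<in> K" for A z i j
  proof -
    let ?D = "automorphy_denom A z"
    have imz: "Im z > 0" using m(1) m(2)[OF z(1)] by simp
    have nz: "?D \<noteq> 0" using automorphy_denom_nonzero[OF det1[OF A]] imz by simp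
    have "m \<le> Im z / (cmod ?D)\<^sup>2" using Im_moebius[OF det1[OF A]] imz m(2)[OF z(2)] by simp
    then have "(cmod ?D)\<^sup>2 \<le> Im z / m" using nz m(1) by (simp add: field_simps)
    also have "\<dots> \<le> R / m" using R(2)[OF z(1)] abs_Im_le_cmod[of z] m(1) by (intro divide_right_mono) auto
    finally have D: "cmod ?D \<le> S" unfolding S_def by (rule real_le_rsqrt)
    have S: "S \<ge> 0" using D norm_ge_zero order_trans by blast
    have c: "\<bar>A $ 2 $ 1\<bar> \<le> S / m"
    proof -
      have "\<bar>A $ 2 $ 1\<bar> * m \<le> \<bar>A $ 2 $ 1\<bar> * Im z" using m(2)[OF z(1)] by (intro mult_left_mono) auto
      also have "\<dots> = \<bar>Im ?D\<bar>" using imz by (simp add: automorphy_denom_def abs_mult)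
      also have "\<dots> \<le> S" using abs_Im_le_cmod[of ?D] D by simp
      finally show ?thesis using m(1) by (simp add: field_simps)
    qed
    have d: "\<bar>A $ 2 $ 2\<bar> \<le> S + S / m * R"
    proof -
      have "complex_of_real (A $ 2 $ 2) = ?D - of_real (A $ 2 $ 1) * z" by (simp add: automorphy_denom_def)
      then have "\<bar>A $ 2 $ 2\<bar> \<le> cmod ?D + \<bar>A $ 2 $ 1\<bar> * cmod z"
        by (metis norm_mult norm_of_real norm_triangle_ineq4)
      also have "\<dots> \<le> S + S / m * R" using D c R z S m by (intro add_mono mult_mono) auto
      finally show ?thesis .
    qed
    have eq: "of_real (A $ 1 $ 1) * z + of_real (A $ 1 $ 2) = moebius A z * ?D"
      using moebius_mult_denom[OF det1[OF A]] imz by simp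
    have nn: "cmod (moebius A z * ?D) \<le> R * S" unfolding norm_mult using R z D by (intro mult_mono) auto
    have a: "\<bar>A $ 1 $ 1\<bar> \<le> R * S / m"
    proof -
      have "\<bar>A $ 1 $ 1\<bar> * m \<le> \<bar>A $ 1 $ 1\<bar> * Im z" using m(2)[OF z(1)] by (intro mult_left_mono) auto
      also have "\<dots> = \<bar>Im (moebius A z * ?D)\<bar>" unfolding eq[symmetric] using imz by (simp add: abs_mult)
      also have "\<dots> \<le> R * S" using abs_Im_le_cmod[of "moebius A z * ?D"] nn by simp
      finally show ?thesis using m(1) by (simp add: field_simps)
    qed
    have b: "\<bar>A $ 1 $ 2\<bar> \<le> R * S + R * S / m * R"
    proof -
      have "complex_of_real (A $ 1 $ 2) = moebius A z * ?D - of_real (A $ 1 $ 1) * z" using eq by (simp add: algebra_simps)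
      then have "\<bar>A $ 1 $ 2\<bar> \<le> cmod (moebius A z * ?D) + \<bar>A $ 1 $ 1\<bar> * cmod z"
        by (metis norm_mult norm_of_real norm_triangle_ineq4)
      also have "\<dots> \<le> R * S + R * S / m * R" using nn a R z S m by (intro add_mono mult_mono) auto
      finally show ?thesis .
    qed
    have "0 \<le> S / m" "0 \<le> R * S / m" using S m R by auto
    then show ?thesis using a b c d exhaust_2[of i] exhaust_2[of j] unfolding T_def by auto
  qed
  then have "{A \<in> G. \<exists>z\<in>K. moebius A z \<in> K} \<subseteq> {A \<in> G. \<forall>i j. \<bar>A $ i $ j\<bar> \<le> T}" by blast
  then show ?thesis using finite_bounded finite_subset by blast
qed simp

end

section \<open>Counting orbits and the images of infinity\<close>

context dense_orbit_group
begin

lemma mat1_mem: "mat 1 \<in> G"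
proof -
  obtain A where "A \<in> G" using orbit_dense[of \<i> 1] by auto
  then show ?thesis using mult_closed[OF adj2_closed[of A] \<open>A \<in> G\<close>] adj2_mult(1)[OF det1[of A]] by simp
qed

text \<open>Each orbit meets K in a finite set, so infinitely many points of K lie on infinitely
  many orbits; one point of C is chosen on each.\<close>

lemma infinite_inequivalent_subset:
  assumes K: "compact K" "K \<subseteq> upper_half_plane"
    and inf: "infinite {z \<in> K. \<exists>A\<in>G. moebius A z \<in> C}" and C: "C \<subseteq> upper_half_plane"
  shows "\<exists>S\<subseteq>C. infinite S \<and> pairwise (\<lambda>z w. \<not> (\<exists>A\<in>G. w = moebius A z)) S"
proof -
  define Z where "Z = {z \<in> K. \<exists>A\<in>G. moebius A z \<in> C}"
  define Orb where "Orb z = (\<lambda>A. moebius A z) ` G" for z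
  have Orb_sub: "Orb w \<subseteq> Orb z" if "Im z > 0" "w \<in> Orb z" for z w
  proof
    note wz = that
    fix v assume "v \<in> Orb w"
    then obtain A where "A \<in> G" "v = moebius A w" by (auto simp: Orb_def)
    moreover obtain B where "B \<in> G" "w = moebius B z" using wz(2) by (auto simp: Orb_def)
    ultimately have "A \<in> G" "B \<in> G" "v = moebius A (moebius B z)" by simp_all
    then show "v \<in> Orb z" using moebius_mult[OF det1 det1, of A B z] mult_closed wz(1)
      by (auto simp: Orb_def intro!: image_eqI[of _ _ "A ** B"])
  qed
  have Orb_sym: "z \<in> Orb w" if "Im z > 0" "w \<in> Orb z" for z w
  proof -
    note wz = that
    obtain A where "A \<in> G" "w = moebius A z" using wz(2) by (auto simp: Orb_def)
    then show ?thesis using moebius_adj2(1)[OF det1, of A z] adj2_closed wz(1)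
      by (auto simp: Orb_def intro!: image_eqI[of _ _ "adj2 A"])
  qed
  have Im_Orb: "Im w > 0" if "Im z > 0" "w \<in> Orb z" for z w
    using that Im_moebius_pos det1 by (auto simp: Orb_def)
  have Orb_eq: "Orb w = Orb z" if "Im z > 0" "w \<in> Orb z" for z w
    using Orb_sub[OF that] Orb_sub[OF Im_Orb[OF that] Orb_sym[OF that]] by blast
  have Orb_refl: "z \<in> Orb z" for z
    using mat1_mem by (auto simp: Orb_def intro!: image_eqI[of _ _ "mat 1"])
  have ZH: "Im z > 0" if "z \<in> Z" for z using that K(2) by (auto simp: Z_def upper_half_plane_def)
  have "infinite (Orb ` Z)"
  proof
    assume fin: "finite (Orb ` Z)"
    have "finite (Orb z \<inter> K)" if "z \<in> Z" for z
    proof -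
      have "z \<in> K" using that by (simp add: Z_def)
      then have "Orb z \<inter> K \<subseteq> (\<lambda>A. moebius A z) ` {A \<in> G. \<exists>z\<in>K. moebius A z \<in> K}"
        by (auto simp: Orb_def)
      then show ?thesis using finite_return[OF K] finite_surj by blast
    qed
    then have "finite (\<Union>V\<in>Orb ` Z. V \<inter> K)" using fin by blast
    moreover have "Z \<subseteq> (\<Union>V\<in>Orb ` Z. V \<inter> K)" using Orb_refl by (auto simp: Z_def)
    ultimately show False using inf finite_subset unfolding Z_def by blast
  qed
  have "\<exists>s. s \<in> C \<and> s \<in> V" if "V \<in> Orb ` Z" for V
    using that by (auto simp: Z_def Orb_def)
  then obtain s where s: "\<And>V. V \<in> Orb ` Z \<Longrightarrow> s V \<in> C \<and> s V \<in> V" by metis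
  have Orb_s: "Orb (s V) = V" if "V \<in> Orb ` Z" for V
    using that s[OF that] Orb_eq ZH by auto
  have inj: "inj_on s (Orb ` Z)" using Orb_s by (metis inj_onI)
  show ?thesis
  proof (intro exI conjI)
    show "s ` Orb ` Z \<subseteq> C" using s by auto
    show "infinite (s ` Orb ` Z)" using \<open>infinite (Orb ` Z)\<close> finite_imageD[OF _ inj] by blast
    show "pairwise (\<lambda>z w. \<not> (\<exists>A\<in>G. w = moebius A z)) (s ` Orb ` Z)"
    proof (rule pairwiseI, rule notI)
      fix z w assume zw: "z \<in> s ` Orb ` Z" "w \<in> s ` Orb ` Z" "z \<noteq> w" "\<exists>A\<in>G. w = moebius A z"
      then obtain V W where VW: "V \<in> Orb ` Z" "W \<in> Orb ` Z" "z = s V" "w = s W" by blast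
      have "w \<in> Orb z" using zw(4) by (auto simp: Orb_def)
      moreover have "Im z > 0" using VW(1,3) s[OF VW(1)] C by (auto simp: upper_half_plane_def)
      ultimately have "Orb w = Orb z" using Orb_eq by blast
      then show False using Orb_s VW zw(3) by metis
    qed
  qed
qed

text \<open>The number - d / c is A^-1 \<infinity>, so passing to inverses reduces this to density
  of the orbit of \<infinity>.\<close>

lemma infinite_cusps_near:
  assumes "\<epsilon> > 0"
  shows "infinite {t. \<bar>t - x\<bar> < \<epsilon> \<and> (\<exists>A\<in>G. A $ 2 $ 1 \<noteq> 0 \<and> t = - A $ 2 $ 2 / A $ 2 $ 1)}"
proof -
  define T where "T = {t. \<exists>A\<in>G. A $ 2 $ 1 \<noteq> 0 \<and> t = - A $ 2 $ 2 / A $ 2 $ 1}"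
  have T: "\<exists>t\<in>T. \<bar>t - x\<bar> < \<epsilon>" if e: "\<epsilon> > 0" for x \<epsilon>
  proof -
    obtain A where A: "A \<in> G" "A $ 2 $ 1 \<noteq> 0" "\<bar>A $ 1 $ 1 / A $ 2 $ 1 - x\<bar> < \<epsilon>"
      using cusp_orbit_dense[OF e] by blast
    then show ?thesis
      by (intro bexI[of _ "A $ 1 $ 1 / A $ 2 $ 1"])
         (auto simp: T_def intro!: bexI[of _ "adj2 A"] adj2_closed)
  qed
  have "x islimpt T"
    unfolding islimpt_approachable
  proof (intro allI impI)
    fix e :: real assume e: "e > 0"
    \<comment> \<open>Aiming at x + e / 2 with tolerance e / 4 keeps t different from x.\<close>
    obtain t where "t \<in> T" "\<bar>t - (x + e / 2)\<bar> < e / 4" using T[of "e / 4" "x + e / 2"] e by auto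
    then show "\<exists>x'\<in>T. x' \<noteq> x \<and> dist x' x < e"
      by (intro bexI[of _ t]) (use e in \<open>auto simp: dist_real_def abs_if split: if_splits\<close>)
  qed
  then have "infinite (T \<inter> ball x \<epsilon>)" using assms by (simp add: islimpt_eq_infinite_ball)
  moreover have "T \<inter> ball x \<epsilon> = {t. \<bar>t - x\<bar> < \<epsilon> \<and> (\<exists>A\<in>G. A $ 2 $ 1 \<noteq> 0 \<and> t = - A $ 2 $ 2 / A $ 2 $ 1)}"
    by (auto simp: T_def dist_real_def abs_minus_commute)
  ultimately show ?thesis by simp
qed

end

section \<open>Holomorphic self-maps commuting with a dilation\<close>

text \<open>Both claims rest on |z - cnj a|^2 - |z - a|^2 = 4 Im a Im z.\<close>

lemma half_plane_denom:
  assumes "Im a > 0" "Im z > 0"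
  shows "z - cnj a \<noteq> 0" "cmod ((z - a) / (z - cnj a)) < 1"
proof -
  show nz: "z - cnj a \<noteq> 0"
  proof
    assume "z - cnj a = 0"
    then have "Im (z - cnj a) = 0" by simp
    then show False using assms by simp
  qed
  have "(cmod (z - a))\<^sup>2 < (cmod (z - cnj a))\<^sup>2"
    unfolding cmod_power2 using mult_pos_pos[OF assms] by (simp add: power2_eq_square algebra_simps)
  then have "cmod (z - a) < cmod (z - cnj a)" by (rule power_less_imp_less_base) simp
  then show "cmod ((z - a) / (z - cnj a)) < 1" using nz by (simp add: norm_divide)
qed

lemma inverse_cayley:
  assumes "cmod \<zeta> < 1"
  defines "z \<equiv> \<i> * (1 + \<zeta>) / (1 - \<zeta>)"
  shows "1 - \<zeta> \<noteq> 0" "Im z > 0" "(z - \<i>) / (z + \<i>) = \<zeta>"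
proof -
  show n: "1 - \<zeta> \<noteq> 0" using assms(1) by auto
  have zi: "z + \<i> = 2 * \<i> / (1 - \<zeta>)" "z - \<i> = 2 * \<i> * \<zeta> / (1 - \<zeta>)"
    using n by (simp_all add: z_def field_simps)
  show "(z - \<i>) / (z + \<i>) = \<zeta>" unfolding zi using n by simp
  have "(cmod (z - \<i>))\<^sup>2 < (cmod (z + \<i>))\<^sup>2"
    unfolding zi norm_mult norm_divide using assms(1) n
    by (intro power_strict_mono) (auto simp: divide_simps)
  then show "Im z > 0" unfolding cmod_power2 by (simp add: power2_eq_square algebra_simps)
qed

text \<open>Equality in the Schwarz--Pick inequality for the points \<open>\<i>\<close> and \<open>m \<i>\<close>, which lie on the axis of the
  dilation: a holomorphic self-map commuting with it cannot contract this distance.\<close>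

lemma dilation_equivariant_selfmap:
  assumes holo: "h holomorphic_on upper_half_plane"
    and self: "\<And>z. Im z > 0 \<Longrightarrow> Im (h z) > 0"
    and m: "m > 0" "m \<noteq> 1" and eqv: "\<And>z. Im z > 0 \<Longrightarrow> h (of_real m * z) = of_real m * h z"
  obtains r where "r > 0" "\<And>z. Im z > 0 \<Longrightarrow> h z = of_real r * z"
proof -
  define w where "w = h \<i>"
  have w: "Im w > 0" using self[of \<i>] by (simp add: w_def)
  define \<psi> where "\<psi> = (\<lambda>\<zeta>::complex. \<i> * (1 + \<zeta>) / (1 - \<zeta>))"
  define F where "F = (\<lambda>\<zeta>. (h (\<psi> \<zeta>) - w) / (h (\<psi> \<zeta>) - cnj w))"
  have \<psi>: "Im (\<psi> \<zeta>) > 0" "(\<psi> \<zeta> - \<i>) / (\<psi> \<zeta> + \<i>) = \<zeta>" if "cmod \<zeta> < 1" for \<zeta>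
    using inverse_cayley[OF that] by (simp_all add: \<psi>_def)
  have F1: "cmod (F \<zeta>) < 1" if "cmod \<zeta> < 1" for \<zeta>
    using half_plane_denom(2)[OF w self[OF \<psi>(1)[OF that]]] by (simp add: F_def)
  have F0: "F 0 = 0" by (simp add: F_def \<psi>_def w_def)
  have "\<psi> holomorphic_on ball 0 1"
    unfolding \<psi>_def by (intro holomorphic_intros) auto
  moreover have "\<psi> ` ball 0 1 \<subseteq> upper_half_plane" using \<psi>(1) by (auto simp: upper_half_plane_def)
  ultimately have "(h \<circ> \<psi>) holomorphic_on ball 0 1"
    using holomorphic_on_compose_gen[OF _ holo] by blast
  then have "(\<lambda>\<zeta>. h (\<psi> \<zeta>)) holomorphic_on ball 0 1" by (simp add: o_def)
  then have Fh: "F holomorphic_on ball 0 1"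
    unfolding F_def using half_plane_denom(1)[OF w self[OF \<psi>(1)]] by (intro holomorphic_intros) auto
  \<comment> \<open>The Cayley image of m \<i>.\<close>
  define \<zeta>\<^sub>0 where "\<zeta>\<^sub>0 = complex_of_real ((m - 1) / (m + 1))"
  have "\<bar>(m - 1) / (m + 1)\<bar> < 1" "(m - 1) / (m + 1) \<noteq> 0" using m by (auto simp: divide_simps abs_if)
  then have z0: "cmod \<zeta>\<^sub>0 < 1" "\<zeta>\<^sub>0 \<noteq> 0"
    unfolding \<zeta>\<^sub>0_def by (simp_all only: norm_of_real of_real_eq_0_iff not_False_eq_True)
  have psi0: "\<psi> \<zeta>\<^sub>0 = of_real m * \<i>"
  proof -
    have mc: "complex_of_real m + 1 \<noteq> 0"
    proof
      assume "complex_of_real m + 1 = 0"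
      then have "Re (complex_of_real m + 1) = 0" by simp
      then show False using m(1) by simp
    qed
    have "1 + \<zeta>\<^sub>0 = 2 * of_real m / (of_real m + 1)" "1 - \<zeta>\<^sub>0 = 2 / (of_real m + 1)"
      unfolding \<zeta>\<^sub>0_def using mc by (simp_all add: field_simps)
    then show ?thesis unfolding \<psi>_def using mc by simp
  qed
  have hz0: "h (\<psi> \<zeta>\<^sub>0) = of_real m * w" unfolding psi0 w_def using eqv[of \<i>] by simp
  have le: "cmod (F \<zeta>\<^sub>0) \<le> cmod \<zeta>\<^sub>0"
    by (rule Schwarz_Lemma(1)[OF Fh F0 F1 z0(1)])
  define x y where "x = Re w" and "y = Im w"
  have y: "y > 0" using w by (simp add: y_def)
  have wx: "w = Complex x y" by (simp add: x_def y_def)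
  have F\<zeta>: "F \<zeta>\<^sub>0 = of_real (m - 1) * w / (of_real m * w - cnj w)"
    unfolding F_def hz0 by (simp add: algebra_simps)
  \<comment> \<open>The Schwarz inequality at this point reads (m + 1) |w| \<le> |m w - cnj w|;
    squaring leaves 4 m x^2 \<le> 0. So h sends \<i> to the imaginary axis, where equality
    holds.\<close>
  have x0: "x = 0"
  proof -
    have nz: "of_real m * w - cnj w \<noteq> 0"
      using half_plane_denom(1)[OF w, of "of_real m * w"] m w by simp
    have "\<bar>m - 1\<bar> * cmod w / cmod (of_real m * w - cnj w) \<le> \<bar>m - 1\<bar> / (m + 1)"
      using le m(1) unfolding F\<zeta> unfolding \<zeta>\<^sub>0_def norm_divide norm_mult norm_of_real by (simp add: abs_divide)
    then have "\<bar>m - 1\<bar> * ((m + 1) * cmod w) \<le> \<bar>m - 1\<bar> * cmod (of_real m * w - cnj w)"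
      using nz m(1) by (simp add: field_simps)
    then have "(m + 1) * cmod w \<le> cmod (of_real m * w - cnj w)"
      using m(2) by simp
    then have "((m + 1) * cmod w)\<^sup>2 \<le> (cmod (of_real m * w - cnj w))\<^sup>2"
      using m(1) by (intro power_mono) auto
    then have "(m + 1)\<^sup>2 * (x\<^sup>2 + y\<^sup>2) \<le> ((m - 1) * x)\<^sup>2 + ((m + 1) * y)\<^sup>2"
      unfolding power_mult_distrib cmod_power2 by (simp add: x_def y_def algebra_simps power_mult_distrib[symmetric])
    then have "4 * m * x\<^sup>2 \<le> 0" by (simp add: power2_eq_square algebra_simps)
    then show ?thesis using m(1) by (simp add: mult_le_0_iff)
  qed
  have wi: "w = of_real y * \<i>" unfolding wx x0 by (simp add: complex_eq_iff)
  have F\<zeta>': "F \<zeta>\<^sub>0 = \<zeta>\<^sub>0"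
  proof -
    have "of_real m * w - cnj w = of_real (m + 1) * w" unfolding wi by (simp add: algebra_simps)
    moreover have "w \<noteq> 0" using w by auto
    ultimately show ?thesis unfolding F\<zeta> unfolding \<zeta>\<^sub>0_def by simp
  qed
  have "\<exists>\<alpha>. (\<forall>z. norm z < 1 \<longrightarrow> F z = \<alpha> * z) \<and> norm \<alpha> = 1"
    by (rule Schwarz_Lemma(3)[OF Fh F0 F1 z0(1)]) (use z0 F\<zeta>' in auto)
  then obtain \<alpha> where \<alpha>: "\<And>z. norm z < 1 \<Longrightarrow> F z = \<alpha> * z" by blast
  then have "\<alpha> = 1" using \<alpha>[OF z0(1)] F\<zeta>' z0(2) by simp
  then have FI: "F z = z" if "norm z < 1" for z using \<alpha>[OF that] by simp
  have "h z = of_real y * z" if z: "Im z > 0" for z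
  proof -
    define \<zeta> where "\<zeta> = (z - \<i>) / (z + \<i>)"
    have zi: "z + \<i> \<noteq> 0" and n\<zeta>: "cmod \<zeta> < 1"
      using half_plane_denom[of \<i> z] z by (auto simp: \<zeta>_def)
    have "1 - \<zeta> = 2 * \<i> / (z + \<i>)" "1 + \<zeta> = 2 * z / (z + \<i>)" using zi by (simp_all add: \<zeta>_def field_simps)
    then have "\<psi> \<zeta> = z" unfolding \<psi>_def using zi by simp
    then have e: "(h z - w) / (h z - cnj w) = (z - \<i>) / (z + \<i>)"
      using FI[OF n\<zeta>] by (simp add: F_def \<zeta>_def)
    have "h z - cnj w \<noteq> 0" using half_plane_denom(1)[OF w self[OF z]] .
    then have "(h z - w) * (z + \<i>) = (z - \<i>) * (h z - cnj w)"
      using e zi by (simp add: frac_eq_eq)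
    then have "2 * \<i> * (h z) = 2 * \<i> * (of_real y * z)" unfolding wi by (simp add: algebra_simps)
    then show ?thesis by (rule mult_left_cancel[THEN iffD1, rotated]) simp
  qed
  then show ?thesis using that y by blast
qed

section \<open>The equivariant map of an automorphic form\<close>

text \<open>For c \<noteq> 0 the value c z + d is not real and avoids the branch cut. For c = 0 it
  may lie on the cut, but the function is constant.\<close>

lemma powr_automorphy_denom_has_field_derivative:
  assumes "det A = 1" "Im z > 0"
  shows "((\<lambda>z. automorphy_denom A z powr s) has_field_derivative
     s * of_real (A $ 2 $ 1) * (automorphy_denom A z powr s) / automorphy_denom A z) (at z)"
proof (cases "A $ 2 $ 1 = 0")
  case True
  then show ?thesis by (simp add: automorphy_denom_def)
next
  case False
  let ?D = "automorphy_denom A z"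
  have nz: "?D \<noteq> 0" using automorphy_denom_nonzero assms by simp
  have "Im ?D \<noteq> 0" using False assms(2) by (simp add: automorphy_denom_def)
  then have np: "?D \<notin> \<real>\<^sub>\<le>\<^sub>0" by (auto simp: complex_nonpos_Reals_iff)
  have d: "(automorphy_denom A has_field_derivative of_real (A $ 2 $ 1)) (at z)"
  proof -
    have "((\<lambda>z. of_real (A $ 2 $ 1) * z + of_real (A $ 2 $ 2)) has_field_derivative of_real (A $ 2 $ 1)) (at z)"
      by (auto intro!: derivative_eq_intros)
    then show ?thesis by (simp add: automorphy_denom_def[abs_def])
  qed
  have "((\<lambda>z. automorphy_denom A z powr s) has_field_derivative
     s * ?D powr (s - 1) * of_real (A $ 2 $ 1)) (at z)"
    by (rule DERIV_chain2[OF has_field_derivative_powr[OF np] d])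
  moreover have "?D powr (s - 1) = ?D powr s / ?D" using nz by (simp add: powr_diff)
  ultimately show ?thesis by (simp add: algebra_simps)
qed

text \<open>The normalised value at a pole is 0, so a nonzero value excludes a pole.\<close>

lemma nicely_meromorphic_on_nonzero_imp_analytic:
  assumes "f nicely_meromorphic_on S" "z \<in> S" "f z \<noteq> 0"
  shows "f analytic_on {z}"
proof -
  have "f \<midarrow>z\<rightarrow> f z" using assms by (auto simp: nicely_meromorphic_on_def)
  then have "\<not> is_pole f z" unfolding is_pole_def
    using not_tendsto_and_filterlim_at_infinity[of "at z" f "f z"] by auto
  then show ?thesis using nicely_meromorphic_on_imp_analytic_at assms by blast
qed

locale automorphic_form = dense_orbit_group +
  fixes k :: real and \<nu> :: "real^2^2 \<Rightarrow> complex" and f :: "complex \<Rightarrow> complex"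
  assumes k: "k \<noteq> 0"
    and multiplier_nonzero: "A \<in> G \<Longrightarrow> \<nu> A \<noteq> 0"
    and mero: "f nicely_meromorphic_on upper_half_plane"
    and transform: "A \<in> G \<Longrightarrow> Im z > 0 \<Longrightarrow>
      automorphy_denom A z powr (- of_real k) * f (moebius A z) = \<nu> A * f z"
begin

text \<open>At zeros and poles of f the value is z, since f z = 0 there. Where f' = 0 and f \<noteq>
  0 the true value is \<infinity>, whereas division by zero returns z; the commutation law below
  excludes that case.\<close>

definition equivariant_map :: "complex \<Rightarrow> complex" where
  "equivariant_map z = z + of_real k * f z / deriv f z"

lemma denom_nonzero: "A \<in> G \<Longrightarrow> Im z > 0 \<Longrightarrow> automorphy_denom A z \<noteq> 0"
  using automorphy_denom_nonzero det1 by simp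

lemma moebius_pos: "A \<in> G \<Longrightarrow> Im z > 0 \<Longrightarrow> Im (moebius A z) > 0"
  using Im_moebius_pos det1 by simp

lemma form_nonzero_iff: "A \<in> G \<Longrightarrow> Im z > 0 \<Longrightarrow> f (moebius A z) = 0 \<longleftrightarrow> f z = 0"
  using transform[of A z] multiplier_nonzero[of A] denom_nonzero[of A z] by auto

lemma analytic: "Im z > 0 \<Longrightarrow> f z \<noteq> 0 \<Longrightarrow> f analytic_on {z}"
  using nicely_meromorphic_on_nonzero_imp_analytic[OF mero] by (simp add: upper_half_plane_def)

lemma has_deriv: "Im z > 0 \<Longrightarrow> f z \<noteq> 0 \<Longrightarrow> (f has_field_derivative deriv f z) (at z)"
  using analytic analytic_on_imp_differentiable_at DERIV_deriv_iff_field_differentiable by blast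

text \<open>Differentiate the transformation law, then use the law itself to eliminate \<nu> A and
  the power. The factor \<open>f z\<close> comes from this elimination, and no choice of branch is
  left.\<close>

lemma deriv_moebius:
  assumes A: "A \<in> G" and z: "Im z > 0" and fz: "f z \<noteq> 0"
  defines "D \<equiv> automorphy_denom A z"
  shows "deriv f (moebius A z) * f z = f (moebius A z) * D * (D * deriv f z + of_real (k * A $ 2 $ 1) * f z)"
proof -
  let ?s = "- complex_of_real k"
  have D: "D \<noteq> 0" using denom_nonzero[OF A z] by (simp add: D_def)
  have pw: "D powr ?s \<noteq> 0" using D by simp
  have fA: "f (moebius A z) \<noteq> 0" using form_nonzero_iff[OF A z] fz by simp
  let ?L = "\<lambda>w. automorphy_denom A w powr ?s * f (moebius A w)"
  have d1: "(?L has_field_derivative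
      (?s * of_real (A $ 2 $ 1) * (D powr ?s) / D * f (moebius A z) +
        (deriv f (moebius A z) * (1 / D\<^sup>2)) * D powr ?s)) (at z)"
    unfolding D_def
    by (rule DERIV_mult[OF powr_automorphy_denom_has_field_derivative
          DERIV_chain2[OF has_deriv moebius_has_field_derivative]])
       (use det1[OF A] z moebius_pos[OF A z] fA in auto)
  have "((\<lambda>w. \<nu> A * f w) has_field_derivative \<nu> A * deriv f z) (at z)"
    by (rule DERIV_cmult[OF has_deriv[OF z fz]])
  then have "(?L has_field_derivative \<nu> A * deriv f z) (at z)"
    by (rule has_field_derivative_transform_within_open[OF _ open_upper_half_plane])
       (use z transform[OF A] in \<open>auto simp: upper_half_plane_def\<close>)
  then have e: "\<nu> A * deriv f z = ?s * of_real (A $ 2 $ 1) * (D powr ?s) / D * f (moebius A z) +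
        (deriv f (moebius A z) * (1 / D\<^sup>2)) * D powr ?s"
    using DERIV_unique d1 by blast
  have t: "D powr ?s * f (moebius A z) = \<nu> A * f z" using transform[OF A z] by (simp add: D_def)
  define P where "P = D powr ?s"
  have P: "P \<noteq> 0" "\<nu> A * f z = P * f (moebius A z)" using pw t by (simp_all add: P_def)
  have "P * f (moebius A z) * deriv f z = (\<nu> A * deriv f z) * f z" unfolding P(2)[symmetric] by simp
  also have "\<dots> = (- of_real k * of_real (A $ 2 $ 1) * P / D * f (moebius A z) +
        (deriv f (moebius A z) * (1 / D\<^sup>2)) * P) * f z" unfolding e P_def by simp
  also have "\<dots> = P * ((- of_real k * of_real (A $ 2 $ 1) / D * f (moebius A z) +
        deriv f (moebius A z) * (1 / D\<^sup>2)) * f z)" by (simp add: algebra_simps)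
  finally have "f (moebius A z) * deriv f z = (- of_real k * of_real (A $ 2 $ 1) / D * f (moebius A z) +
        deriv f (moebius A z) * (1 / D\<^sup>2)) * f z" using P(1) by (simp add: mult.assoc)
  then have "f (moebius A z) * deriv f z * D\<^sup>2 = (- of_real k * of_real (A $ 2 $ 1) / D * f (moebius A z) +
        deriv f (moebius A z) * (1 / D\<^sup>2)) * f z * D\<^sup>2" by simp
  also have "\<dots> = - of_real k * of_real (A $ 2 $ 1) * D * f (moebius A z) * f z + deriv f (moebius A z) * f z"
    using D by (simp add: field_simps power2_eq_square)
  finally show ?thesis by (simp add: algebra_simps power2_eq_square)
qed

text \<open>For f z \<noteq> 0, c h(z) + d is E / f'(z), where E is a nonzero multiple of f'(A z).
  Read backwards, a zero of c h(z) + d makes A z critical; this is how critical points are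
  found.\<close>

lemma equivariant_map_moebius:
  assumes A: "A \<in> G" and z: "Im z > 0"
    and d: "f z \<noteq> 0 \<Longrightarrow> deriv f z \<noteq> 0" "f z \<noteq> 0 \<Longrightarrow> deriv f (moebius A z) \<noteq> 0"
  shows "automorphy_denom A (equivariant_map z) \<noteq> 0"
    "equivariant_map (moebius A z) = moebius A (equivariant_map z)"
proof -
  define D where "D = automorphy_denom A z"
  have D: "D \<noteq> 0" using denom_nonzero[OF A z] by (simp add: D_def)
  show dn: "automorphy_denom A (equivariant_map z) \<noteq> 0"
    and "equivariant_map (moebius A z) = moebius A (equivariant_map z)"
  proof (atomize (full), cases "f z = 0")
    case True
    then show "automorphy_denom A (equivariant_map z) \<noteq> 0 \<and>
      equivariant_map (moebius A z) = moebius A (equivariant_map z)"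
      using D form_nonzero_iff[OF A z] by (simp add: equivariant_map_def D_def)
  next
    case False
    let ?c = "complex_of_real (A $ 2 $ 1)" and ?k = "complex_of_real k"
    define E where "E = D * deriv f z + ?k * ?c * f z"
    have dm: "deriv f (moebius A z) * f z = f (moebius A z) * D * E"
      using deriv_moebius[OF A z False] by (simp add: E_def D_def)
    have fA: "f (moebius A z) \<noteq> 0" using form_nonzero_iff[OF A z] False by simp
    have E: "E \<noteq> 0" using dm d False by auto
    have dz: "deriv f z \<noteq> 0" "deriv f (moebius A z) \<noteq> 0" using d False by auto
    have dh: "automorphy_denom A (equivariant_map z) = E / deriv f z"
      using dz by (simp add: equivariant_map_def E_def D_def automorphy_denom_def field_simps)
    then have dnz: "automorphy_denom A (equivariant_map z) \<noteq> 0" using E dz by simp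
    have "moebius A (equivariant_map z) - moebius A z = (equivariant_map z - z) / (E / deriv f z * D)"
      using moebius_diff[OF det1[OF A] dnz, of z] D dh by (simp add: D_def)
    also have "\<dots> = ?k * f z / (E * D)" using dz E D by (simp add: equivariant_map_def)
    also have "\<dots> = ?k * f (moebius A z) / deriv f (moebius A z)"
      using dm dz E D fA by (simp add: field_simps)
    also have "\<dots> = equivariant_map (moebius A z) - moebius A z" by (simp add: equivariant_map_def)
    finally show "automorphy_denom A (equivariant_map z) \<noteq> 0 \<and>
      equivariant_map (moebius A z) = moebius A (equivariant_map z)" using dnz by simp
  qed
qed

lemma mem_critical_points:
  assumes "Im z > 0" "f z \<noteq> 0"
  shows "z \<in> critical_points f \<longleftrightarrow> deriv f z = 0"
  using has_deriv[OF assms] assms(1) DERIV_imp_deriv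
  by (auto simp: critical_points_def upper_half_plane_def)

end

text \<open>The assumption to be refuted. By \<open>infinite_inequivalent_subset\<close>, a compact
  set violating it would yield infinitely many inequivalent critical points.\<close>

locale finitely_critical_form = automorphic_form +
  assumes finite_critical: "compact K \<Longrightarrow> K \<subseteq> upper_half_plane \<Longrightarrow>
    finite {z \<in> K. \<exists>A\<in>G. moebius A z \<in> critical_points f}"
begin

lemma exists_noncritical_orbit:
  assumes "open V" "V \<noteq> {}" "V \<subseteq> upper_half_plane"
  obtains z where "z \<in> V" "\<And>A. A \<in> G \<Longrightarrow> moebius A z \<notin> critical_points f"
proof -
  obtain z0 where "z0 \<in> V" using assms(2) by blast
  then obtain e where e: "e > 0" "cball z0 e \<subseteq> V" using assms(1) open_contains_cball by blast
  have "infinite (cball z0 e)" using uncountable_cball[OF e(1)] countable_finite by blast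
  moreover have "finite {z \<in> cball z0 e. \<exists>A\<in>G. moebius A z \<in> critical_points f}"
    using finite_critical[of "cball z0 e"] e assms(3) by auto
  ultimately have "\<not> cball z0 e \<subseteq> {z \<in> cball z0 e. \<exists>A\<in>G. moebius A z \<in> critical_points f}"
    using finite_subset by blast
  then show ?thesis using that e(2) by blast
qed

text \<open>If zeros accumulated at z, then f would vanish identically, and every point would be
  critical, against local finiteness.\<close>

lemma eventually_nonzero:
  assumes z: "Im z > 0"
  shows "\<forall>\<^sub>F w in at z. f w \<noteq> 0"
proof (rule ccontr)
  assume "\<not> ?thesis"
  then have "frequently (\<lambda>w. f w = 0) (at z)" by (simp add: frequently_def)
  then have f0: "f w = 0" if "w \<in> upper_half_plane" for w
    using frequently_eq_meromorphic_imp_constant[OF _ mero open_upper_half_plane _ _ that] z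
    by (auto simp: upper_half_plane_def convex_connected convex_halfspace_Im_gt)
  have crit: "w \<in> critical_points f" if w: "w \<in> upper_half_plane" for w
  proof -
    have "(f has_field_derivative 0) (at w)"
      by (rule has_field_derivative_transform_within_open[OF _ open_upper_half_plane w, of "\<lambda>_. 0"])
         (auto simp: f0)
    then show ?thesis using w by (simp add: critical_points_def)
  qed
  obtain w where "w \<in> upper_half_plane" "\<And>A. A \<in> G \<Longrightarrow> moebius A w \<notin> critical_points f"
    using exists_noncritical_orbit[OF open_upper_half_plane] z by (auto simp: upper_half_plane_def)
  then show False using mat1_mem crit by force
qed

lemma regular_neighbourhood:
  assumes z: "Im z > 0" "f z \<noteq> 0" "deriv f z \<noteq> 0"
  obtains e where "e > 0" "cball z e \<subseteq> upper_half_plane" "f holomorphic_on ball z e"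
    "\<And>w. w \<in> ball z e \<Longrightarrow> f w \<noteq> 0 \<and> deriv f w \<noteq> 0"
proof -
  obtain e1 where e1: "e1 > 0" "f holomorphic_on ball z e1"
    using analytic[OF z(1,2)] by (auto simp: analytic_on_def)
  obtain e2 where e2: "e2 > 0" "cball z e2 \<subseteq> upper_half_plane"
    using open_upper_half_plane z(1) unfolding open_contains_cball by (auto simp: upper_half_plane_def)
  have "isCont f z" using has_deriv[OF z(1,2)] DERIV_isCont by blast
  then have ev1: "\<forall>\<^sub>F w in nhds z. f w \<noteq> 0"
    using z(2) by (simp add: isCont_def tendsto_imp_eventually_ne eventually_nhds_conv_at)
  have "(deriv f) holomorphic_on ball z e1" using e1 holomorphic_deriv by blast
  then have "isCont (deriv f) z" using e1(1)
    by (metis centre_in_ball continuous_on_eq_continuous_at holomorphic_on_imp_continuous_on open_ball)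
  then have ev2: "\<forall>\<^sub>F w in nhds z. deriv f w \<noteq> 0"
    using z(3) by (simp add: isCont_def tendsto_imp_eventually_ne eventually_nhds_conv_at)
  obtain e3 where e3: "e3 > 0" "\<And>w. dist w z < e3 \<Longrightarrow> f w \<noteq> 0 \<and> deriv f w \<noteq> 0"
    using eventually_conj[OF ev1 ev2] unfolding eventually_nhds_metric by blast
  define e where "e = min e1 (min e2 e3)"
  show ?thesis
  proof (rule that[of e])
    show "e > 0" using e1 e2 e3 by (simp add: e_def)
    show "cball z e \<subseteq> upper_half_plane" using e2(2) by (auto simp: e_def)
    show "f holomorphic_on ball z e" using e1(2) by (rule holomorphic_on_subset) (auto simp: e_def)
    show "f w \<noteq> 0 \<and> deriv f w \<noteq> 0" if "w \<in> ball z e" for w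
      using that e3(2)[of w] by (simp add: e_def dist_commute)
  qed
qed

lemma equivariant_map_holomorphic_regular:
  assumes "f holomorphic_on S" "open S" "\<And>w. w \<in> S \<Longrightarrow> deriv f w \<noteq> 0"
  shows "equivariant_map holomorphic_on S"
  unfolding equivariant_map_def[abs_def]
  by (intro holomorphic_intros holomorphic_deriv assms) (use assms in auto)

text \<open>By the identity theorem h would equal x at all regular points, and equivariance would
  make x a common fixed point of G. The identity theorem is applied to
  \<open>remove_sings equivariant_map\<close>, because h itself has default values at critical
  points.\<close>

lemma not_locally_constant_real:
  assumes z0: "Im z0 > 0" "f z0 \<noteq> 0" "deriv f z0 \<noteq> 0"
    and e: "e > 0" "ball z0 e \<subseteq> upper_half_plane"
    and const: "\<And>w. w \<in> ball z0 e \<Longrightarrow> equivariant_map w = of_real x"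
    and nz: "\<And>w. w \<in> ball z0 e \<Longrightarrow> f w \<noteq> 0 \<and> deriv f w \<noteq> 0"
  shows False
proof -
  have "f meromorphic_on upper_half_plane" using mero by (simp add: nicely_meromorphic_on_def)
  then have "equivariant_map meromorphic_on upper_half_plane"
    unfolding equivariant_map_def[abs_def]
    by (intro meromorphic_intros)
  then have nm: "remove_sings equivariant_map nicely_meromorphic_on upper_half_plane"
    by (rule remove_sings_nicely_meromorphic)
  have eq: "remove_sings equivariant_map w = equivariant_map w" if w: "Im w > 0" "f w \<noteq> 0" "deriv f w \<noteq> 0" for w
  proof (rule remove_sings_at_analytic)
    obtain d where d: "d > 0" "f holomorphic_on ball w d" "\<And>v. v \<in> ball w d \<Longrightarrow> f v \<noteq> 0 \<and> deriv f v \<noteq> 0"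
      using regular_neighbourhood[OF w] by metis
    then have "equivariant_map holomorphic_on ball w d"
      by (intro equivariant_map_holomorphic_regular) auto
    then show "equivariant_map analytic_on {w}" using d(1) by (auto simp: analytic_on_def)
  qed
  have "\<forall>\<^sub>F w in at z0. w \<in> ball z0 e"
    using e(1) by (intro eventually_at_in_open') auto
  then have "\<forall>\<^sub>F w in at z0. remove_sings equivariant_map w = of_real x"
  proof eventually_elim
    case (elim w)
    then have "Im w > 0" using e(2) by (auto simp: upper_half_plane_def)
    then show ?case using eq[of w] const[OF elim] nz[OF elim] by simp
  qed
  then have "frequently (\<lambda>w. remove_sings equivariant_map w = of_real x) (at z0)"
    by (intro eventually_frequently) auto
  then have glob: "remove_sings equivariant_map w = of_real x" if "Im w > 0" for w
    using frequently_eq_meromorphic_imp_constant[OF _ nm open_upper_half_plane, of "of_real x" z0 w] z0(1) that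
    by (auto simp: upper_half_plane_def convex_connected convex_halfspace_Im_gt)
  have "ball z0 e \<noteq> {}" using e(1) by simp
  then obtain z where z: "z \<in> ball z0 e" "\<And>A. A \<in> G \<Longrightarrow> moebius A z \<notin> critical_points f"
    using exists_noncritical_orbit[OF open_ball _ e(2)] by metis
  have zH: "Im z > 0" using z(1) e(2) by (auto simp: upper_half_plane_def)
  have hz: "equivariant_map z = of_real x" using const z(1) by blast
  obtain A where A: "A \<in> G" "(A $ 1 $ 1 * x + A $ 1 $ 2 * 1) * 1 \<noteq> (A $ 2 $ 1 * x + A $ 2 $ 2 * 1) * x"
    using no_common_eigenvector[of x 1] by auto
  have Az: "Im (moebius A z) > 0" "f (moebius A z) \<noteq> 0"
    using moebius_pos[OF A(1) zH] form_nonzero_iff[OF A(1) zH] nz[OF z(1)] by auto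
  \<comment> \<open>The orbit of z was chosen free of critical points, so A z is regular and h takes
    the value x there as well.\<close>
  have dAz: "deriv f (moebius A z) \<noteq> 0" using z(2)[OF A(1)] mem_critical_points[OF Az] by simp
  have hAz: "equivariant_map (moebius A z) = of_real x" using glob[OF Az(1)] eq[OF Az dAz] by simp
  have "automorphy_denom A (of_real x) \<noteq> 0" "moebius A (of_real x) = of_real x"
    using equivariant_map_moebius[OF A(1) zH] nz[OF z(1)] dAz hz hAz by auto
  then have "complex_of_real (A $ 1 $ 1) * of_real x + of_real (A $ 1 $ 2) = of_real x * automorphy_denom A (of_real x)"
    by (simp add: moebius_def field_simps)
  then have "complex_of_real (A $ 1 $ 1 * x + A $ 1 $ 2) = of_real (x * (A $ 2 $ 1 * x + A $ 2 $ 2))"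
    by (simp add: automorphy_denom_def)
  then have "A $ 1 $ 1 * x + A $ 1 $ 2 = x * (A $ 2 $ 1 * x + A $ 2 $ 2)" by (simp only: of_real_eq_iff)
  then show False using A(2) by (simp add: mult.commute)
qed

lemma equivariant_map_not_real_regular:
  assumes z0: "Im z0 > 0" "f z0 \<noteq> 0" "deriv f z0 \<noteq> 0"
  shows "equivariant_map z0 \<noteq> of_real x"
proof
  assume hz0: "equivariant_map z0 = of_real x"
  obtain e where e: "e > 0" "cball z0 e \<subseteq> upper_half_plane" "f holomorphic_on ball z0 e"
    "\<And>w. w \<in> ball z0 e \<Longrightarrow> f w \<noteq> 0 \<and> deriv f w \<noteq> 0"
    using regular_neighbourhood[OF z0] by metis
  have sub: "ball z0 e \<subseteq> upper_half_plane" using e(2) ball_subset_cball by blast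
  have holo: "equivariant_map holomorphic_on ball z0 e"
    by (rule equivariant_map_holomorphic_regular[OF e(3)]) (use e(4) in auto)
  show False
  proof (cases "equivariant_map constant_on ball z0 e")
    case True
    then have "equivariant_map w = of_real x" if "w \<in> ball z0 e" for w
      using that hz0 e(1) unfolding constant_on_def by (metis centre_in_ball)
    then show False using not_locally_constant_real[OF z0 e(1) sub _ e(4)] by blast
  next
    case False
    then have "open (equivariant_map ` ball z0 e)"
      by (intro open_mapping_thm[OF holo]) auto
    moreover have "complex_of_real x \<in> equivariant_map ` ball z0 e" using hz0 e(1) by (auto intro!: image_eqI[of _ _ z0])
    ultimately obtain \<delta> where \<delta>: "\<delta> > 0" "ball (complex_of_real x) \<delta> \<subseteq> equivariant_map ` ball z0 e"
      using open_contains_ball by blast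
    define T where "T = {t. \<bar>t - x\<bar> < \<delta> \<and> (\<exists>A\<in>G. A $ 2 $ 1 \<noteq> 0 \<and> t = - A $ 2 $ 2 / A $ 2 $ 1)}"
    define Z where "Z = {z \<in> cball z0 e. \<exists>A\<in>G. moebius A z \<in> critical_points f}"
    \<comment> \<open>Each t in T is some A^-1 \<infinity> and equals h(z) for a z in the ball; then
      c h(z) + d = 0, so A z is critical.\<close>
    have "complex_of_real ` T \<subseteq> equivariant_map ` Z"
    proof
      fix s assume "s \<in> complex_of_real ` T"
      then obtain t A where t: "s = of_real t" "\<bar>t - x\<bar> < \<delta>" and A: "A \<in> G" "A $ 2 $ 1 \<noteq> 0" "t = - A $ 2 $ 2 / A $ 2 $ 1"
        by (auto simp: T_def)
      have "dist (complex_of_real x) s < \<delta>" using t by (simp add: dist_norm norm_of_real abs_minus_commute flip: of_real_diff)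
      then obtain z where z: "z \<in> ball z0 e" "equivariant_map z = s" using \<delta>(2) by force
      have zH: "Im z > 0" using z(1) sub by (auto simp: upper_half_plane_def)
      have fz: "f z \<noteq> 0" "deriv f z \<noteq> 0" using e(4)[OF z(1)] by auto
      have "A $ 2 $ 1 * t + A $ 2 $ 2 = 0" using A(2,3) by simp
      then have "automorphy_denom A s = 0"
        unfolding t(1) automorphy_denom_def by (metis of_real_0 of_real_add of_real_mult)
      then have "deriv f (moebius A z) = 0"
        using equivariant_map_moebius(1)[OF A(1) zH] fz(2) z(2) by auto
      moreover have "f (moebius A z) \<noteq> 0" using form_nonzero_iff[OF A(1) zH] fz by simp
      ultimately have "moebius A z \<in> critical_points f"
        using mem_critical_points[OF moebius_pos[OF A(1) zH]] by simp
      then show "s \<in> equivariant_map ` Z" using z A(1) by (auto simp: Z_def)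
    qed
    moreover have "finite Z" unfolding Z_def using finite_critical[OF compact_cball e(2)] .
    ultimately have "finite (complex_of_real ` T)" using finite_surj by blast
    then have "finite T" by (rule finite_imageD) (auto simp: inj_on_def)
    then show False using infinite_cusps_near[OF \<delta>(1)] by (simp add: T_def)
  qed
qed

text \<open>Otherwise h(z) = \<infinity>, and an element with c \<noteq> 0 carries this to the real
  value a / c at the regular point A z. The value is computed directly, since the commutation law
  excludes f'(z) = 0.\<close>

lemma deriv_nonzero:
  assumes z: "Im z > 0" and fz: "f z \<noteq> 0"
  shows "deriv f z \<noteq> 0"
proof
  assume d0: "deriv f z = 0"
  obtain A where A: "A \<in> G" "A $ 2 $ 1 \<noteq> 0" using no_common_eigenvector[of 1 0] by auto
  define D where "D = automorphy_denom A z"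
  have D: "D \<noteq> 0" using denom_nonzero[OF A(1) z] by (simp add: D_def)
  let ?c = "complex_of_real (A $ 2 $ 1)" and ?k = "complex_of_real k"
  define z1 where "z1 = moebius A z"
  have z1: "Im z1 > 0" "f z1 \<noteq> 0"
    using moebius_pos[OF A(1) z] form_nonzero_iff[OF A(1) z] fz by (auto simp: z1_def)
  have "deriv f z1 * f z = f z1 * D * (?k * ?c) * f z"
    using deriv_moebius[OF A(1) z fz] d0 by (simp add: z1_def D_def mult.assoc)
  then have d1: "deriv f z1 = f z1 * D * (?k * ?c)" by (rule mult_right_cancel[OF fz, THEN iffD1])
  have c: "?c \<noteq> 0" "?k \<noteq> 0" using A(2) k by auto
  have "equivariant_map z1 = z1 + 1 / (?c * D)"
    unfolding equivariant_map_def d1 using z1(2) D c by (simp add: field_simps)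
  also have "\<dots> = of_real (A $ 1 $ 1) / ?c"
  proof -
    have "z1 * D = of_real (A $ 1 $ 1) * z + of_real (A $ 1 $ 2)"
      using moebius_mult_denom[OF det1[OF A(1)]] z by (simp add: z1_def D_def)
    then have "z1 * D * ?c + 1 = (of_real (A $ 1 $ 1) * z + of_real (A $ 1 $ 2)) * ?c +
       (of_real (A $ 1 $ 1) * of_real (A $ 2 $ 2) - of_real (A $ 1 $ 2) * of_real (A $ 2 $ 1))"
      using det2_of_real[OF det1[OF A(1)]] by simp
    also have "\<dots> = of_real (A $ 1 $ 1) * D" by (simp add: D_def automorphy_denom_def algebra_simps)
    finally have e: "z1 * D * ?c + 1 = of_real (A $ 1 $ 1) * D" .
    have "z1 + 1 / (?c * D) = (z1 * D * ?c + 1) / (?c * D)" using c D by (simp add: field_simps)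
    also have "\<dots> = of_real (A $ 1 $ 1) / ?c" unfolding e using D by simp
    finally show ?thesis .
  qed
  finally have "equivariant_map z1 = of_real (A $ 1 $ 1 / A $ 2 $ 1)" by simp
  moreover have "deriv f z1 \<noteq> 0" using d1 z1(2) D c by simp
  ultimately show False using equivariant_map_not_real_regular[OF z1] by blast
qed

end

section \<open>Holomorphy of the equivariant map and the contradiction\<close>

context finitely_critical_form
begin

text \<open>At a zero or pole \<open>z0\<close> of \<open>f\<close> of order \<open>n\<close> the quotient \<open>f / f'\<close> vanishes to first order, so the
  map extends holomorphically with \<open>z0\<close> as a fixed point. This agrees with its definition, because
  \<open>f z0 = 0\<close> even at a pole.\<close>

lemma equivariant_map_holomorphic_zero:
  assumes z0: "Im z0 > 0" "f z0 = 0"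
  shows "\<exists>e>0. equivariant_map holomorphic_on ball z0 e"
proof -
  have zH: "z0 \<in> upper_half_plane" using z0 by (simp add: upper_half_plane_def)
  have mf: "f meromorphic_on {z0}"
    using mero zH meromorphic_on_subset unfolding nicely_meromorphic_on_def by blast
  define n where "n = zorder f z0"
  define g where "g = zor_poly f z0"
  have "g z0 \<noteq> 0 \<and> (\<exists>r>0. g holomorphic_on cball z0 r \<and>
      (\<forall>w\<in>cball z0 r - {z0}. f w = g w * (w - z0) powi n \<and> g w \<noteq> 0))"
    unfolding n_def g_def
    by (rule zorder_exist)
       (use mf eventually_nonzero[OF z0(1)] in \<open>auto simp: meromorphic_at_iff intro!: eventually_frequently\<close>)
  then obtain r where g0: "g z0 \<noteq> 0" and r: "r > 0" "g holomorphic_on cball z0 r"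
    "\<And>w. w \<in> cball z0 r - {z0} \<Longrightarrow> f w = g w * (w - z0) powi n \<and> g w \<noteq> 0" by blast
  obtain s where s: "s > 0" "ball z0 s \<subseteq> upper_half_plane"
    using open_upper_half_plane zH open_contains_ball by blast
  define e where "e = min r s"
  have e: "e > 0" "ball z0 e \<subseteq> upper_half_plane" using r(1) s by (auto simp: e_def)
  have gh: "g holomorphic_on ball z0 e" by (rule holomorphic_on_subset[OF r(2)]) (auto simp: e_def)
  have fg: "f w = g w * (w - z0) powi n" "g w \<noteq> 0" if "w \<in> ball z0 e" "w \<noteq> z0" for w
    using r(3)[of w] that by (auto simp: e_def)
  \<comment> \<open>With n = 0 the limit of f at z0 would be g z0 \<noteq> 0; then z0 is no pole,
    and the normalised value f z0 could not be 0.\<close>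
  have n0: "n \<noteq> 0"
  proof
    assume n: "n = 0"
    have "isCont g z0" using gh e(1)
      by (metis centre_in_ball continuous_on_eq_continuous_at holomorphic_on_imp_continuous_on open_ball)
    then have "g \<midarrow>z0\<rightarrow> g z0" by (simp add: isCont_def)
    moreover have "\<forall>\<^sub>F w in at z0. g w = f w"
    proof -
      have "\<forall>\<^sub>F w in at z0. w \<in> ball z0 e - {z0}"
        using e(1) by (intro eventually_at_in_open) auto
      then show ?thesis by eventually_elim (use fg n in auto)
    qed
    ultimately have l: "f \<midarrow>z0\<rightarrow> g z0" using Lim_transform_eventually by blast
    then have "\<not> is_pole f z0"
      unfolding is_pole_def using not_tendsto_and_filterlim_at_infinity[of "at z0" f "g z0"] by auto
    then have "f \<midarrow>z0\<rightarrow> 0" using mero zH z0(2) unfolding nicely_meromorphic_on_def by metis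
    then show False using LIM_unique[OF l] g0 by blast
  qed
  let ?N = "complex_of_int n"
  \<comment> \<open>Away from z0 this is (w - z0)^(1 - n) f'(w), nonzero because f' is; at z0 it is
    n g(z0).\<close>
  define E where "E = (\<lambda>w. deriv g w * (w - z0) + ?N * g w)"
  have loc: "E w \<noteq> 0 \<and> equivariant_map w = w + of_real k * (g w * (w - z0)) / E w" if w: "w \<in> ball z0 e" for w
  proof (cases "w = z0")
    case True
    then show ?thesis using g0 n0 z0(2) by (simp add: E_def equivariant_map_def)
  next
    case False
    define u where "u = w - z0"
    have u: "u \<noteq> 0" using False by (simp add: u_def)
    have wH: "Im w > 0" using w e(2) by (auto simp: upper_half_plane_def)
    have fw: "f w \<noteq> 0" using fg[OF w False] u by (simp add: u_def)
    have gd: "(g has_field_derivative deriv g w) (at w)"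
      using holomorphic_derivI[OF gh open_ball w] .
    have "((\<lambda>w. g w * (w - z0) powi n) has_field_derivative
        deriv g w * u powi n + (?N * u powi (n - 1)) * g w) (at w)"
      unfolding u_def
      by (rule DERIV_mult[OF gd]) (use False in \<open>auto intro!: derivative_eq_intros\<close>)
    then have "(f has_field_derivative deriv g w * u powi n + (?N * u powi (n - 1)) * g w) (at w)"
      by (rule has_field_derivative_transform_within_open[of _ _ _ "ball z0 e - {z0}"])
         (use w False fg in auto)
    then have "deriv f w = deriv g w * u powi n + (?N * u powi (n - 1)) * g w" by (rule DERIV_imp_deriv)
    also have "\<dots> = u powi n / u * (deriv g w * u + ?N * g w)"
      using u by (simp add: power_int_diff field_simps)
    also have "\<dots> = u powi n / u * E w" by (simp add: E_def u_def)
    finally have df: "deriv f w = u powi n / u * E w" .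
    then have "E w \<noteq> 0" using deriv_nonzero[OF wH fw] by auto
    then show ?thesis unfolding equivariant_map_def df fg(1)[OF w False] u_def[symmetric]
      using u by (simp add: field_simps)
  qed
  have "(\<lambda>w. w + of_real k * (g w * (w - z0)) / E w) holomorphic_on ball z0 e"
    unfolding E_def using loc unfolding E_def
    by (intro holomorphic_intros gh holomorphic_deriv) auto
  then have "equivariant_map holomorphic_on ball z0 e"
    by (rule holomorphic_transform) (use loc in auto)
  then show ?thesis using e(1) by blast
qed

lemma equivariant_map_holomorphic: "equivariant_map holomorphic_on upper_half_plane"
proof (rule analytic_imp_holomorphic, unfold analytic_on_def, rule ballI)
  fix z assume "z \<in> upper_half_plane"
  then have z: "Im z > 0" by (simp add: upper_half_plane_def)
  show "\<exists>e>0. equivariant_map holomorphic_on ball z e"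
  proof (cases "f z = 0")
    case False
    obtain e where e: "e > 0" "f holomorphic_on ball z e" "\<And>w. w \<in> ball z e \<Longrightarrow> f w \<noteq> 0 \<and> deriv f w \<noteq> 0"
      using regular_neighbourhood[OF z False deriv_nonzero[OF z False]] by metis
    then show ?thesis using equivariant_map_holomorphic_regular[OF e(2) open_ball] by blast
  qed (use equivariant_map_holomorphic_zero[OF z] in blast)
qed

lemma Im_equivariant_map_nonzero:
  assumes z: "Im z > 0"
  shows "Im (equivariant_map z) \<noteq> 0"
proof (cases "f z = 0")
  case True
  then show ?thesis using z by (simp add: equivariant_map_def)
next
  case False
  show ?thesis
  proof
    assume "Im (equivariant_map z) = 0"
    then have "equivariant_map z = of_real (Re (equivariant_map z))" by (simp add: complex_eq_iff)
    then show False using equivariant_map_not_real_regular[OF z False deriv_nonzero[OF z False]] by blast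
  qed
qed

lemma equivariant_map_commutes:
  assumes A: "A \<in> G" and z: "Im z > 0"
  shows "equivariant_map (moebius A z) = moebius A (equivariant_map z)"
  using equivariant_map_moebius(2)[OF A z] deriv_nonzero[OF z]
    deriv_nonzero[OF moebius_pos[OF A z]] form_nonzero_iff[OF A z] by blast

text \<open>The sign treats both half-planes at once: - h commutes with real dilations whenever h
  does, so \<sigma> h can be fed to the Schwarz--Pick argument.\<close>

lemma equivariant_map_sign:
  obtains \<sigma> :: real where "\<sigma> = 1 \<or> \<sigma> = -1" "\<And>z. Im z > 0 \<Longrightarrow> \<sigma> * Im (equivariant_map z) > 0"
proof -
  have conn: "connected upper_half_plane"
    by (simp add: upper_half_plane_def convex_connected convex_halfspace_Im_gt)
  have "connected ((\<lambda>z. Im (equivariant_map z)) ` upper_half_plane)"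
    by (intro connected_continuous_image conn continuous_intros
        holomorphic_on_imp_continuous_on equivariant_map_holomorphic)
  moreover have "0 \<notin> (\<lambda>z. Im (equivariant_map z)) ` upper_half_plane"
    using Im_equivariant_map_nonzero by (auto simp: upper_half_plane_def)
  ultimately have dich: "\<not> (Im (equivariant_map z) < 0 \<and> Im (equivariant_map w) > 0)"
    if "Im z > 0" "Im w > 0" for z w
    using that connectedD_interval[of "(\<lambda>z. Im (equivariant_map z)) ` upper_half_plane"
        "Im (equivariant_map z)" "Im (equivariant_map w)" 0]
    by (auto simp: upper_half_plane_def)
  show ?thesis
  proof (cases "Im (equivariant_map \<i>) > 0")
    case True
    have "Im (equivariant_map z) > 0" if "Im z > 0" for z
      using dich[OF that, of \<i>] True Im_equivariant_map_nonzero[OF that] by force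
    then show ?thesis using that[of 1] by simp
  next
    case False
    then have "Im (equivariant_map \<i>) < 0" using Im_equivariant_map_nonzero[of \<i>] by simp
    then have "Im (equivariant_map z) < 0" if "Im z > 0" for z
      using dich[of \<i> z] that Im_equivariant_map_nonzero[OF that] by force
    then show ?thesis using that[of "-1"] by simp
  qed
qed

lemma finitely_critical_form_impossible: False
proof -
  obtain A0 where A0: "A0 \<in> G" "\<bar>A0 $ 1 $ 1 + A0 $ 2 $ 2\<bar> > 2" using exists_hyperbolic by blast
  obtain B m where B: "det B = 1" and m: "m \<noteq> 0" "m\<^sup>2 \<noteq> 1" and AB: "A0 ** B = B ** mat2 m 0 0 (1 / m)"
    using hyperbolic_diagonalisable[OF det1[OF A0(1)] A0(2)] by blast
  obtain \<sigma> :: real where \<sigma>: "\<sigma> = 1 \<or> \<sigma> = -1" "\<And>z. Im z > 0 \<Longrightarrow> \<sigma> * Im (equivariant_map z) > 0"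
    using equivariant_map_sign by blast
  have B': "det (adj2 B) = 1" using B by simp
  \<comment> \<open>In the coordinate given by B the hyperbolic element acts as the dilation by
    m^2.\<close>
  define h where "h z = moebius (adj2 B) (equivariant_map (moebius B z))" for z
  have BH: "Im (moebius B z) > 0" if "Im z > 0" for z using Im_moebius_pos[OF B that] .
  have h_eqv: "h (moebius M z) = moebius M (h z)"
    if A: "A \<in> G" and M: "M = adj2 B ** A ** B" and z: "Im z > 0" for A M z
  proof -
    have dM: "det M = 1" using det1[OF A] B by (simp add: M det_mul)
    have BM: "B ** M = A ** B" unfolding M using adj2_mult(2)[OF B] by (simp add: matrix_mul_assoc)
    have MB: "M ** adj2 B = adj2 B ** A"
      unfolding M using adj2_mult(2)[OF B] by (simp add: matrix_mul_assoc[symmetric])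
    let ?w = "equivariant_map (moebius B z)"
    have w: "Im ?w \<noteq> 0" using Im_equivariant_map_nonzero[OF BH[OF z]] .
    have "moebius B (moebius M z) = moebius A (moebius B z)"
      using moebius_mult[OF B dM, of z] moebius_mult[OF det1[OF A] B, of z] z BM by simp
    then have "h (moebius M z) = moebius (adj2 B) (moebius A ?w)"
      using equivariant_map_commutes[OF A BH[OF z]] by (simp add: h_def)
    also have "\<dots> = moebius M (h z)"
      using moebius_mult[OF B' det1[OF A] w] moebius_mult[OF dM B' w] MB by (simp add: h_def)
    finally show ?thesis .
  qed
  have h_sign: "\<sigma> * Im (h z) > 0" if z: "Im z > 0" for z
  proof -
    let ?w = "equivariant_map (moebius B z)"
    have w: "Im ?w \<noteq> 0" using Im_equivariant_map_nonzero[OF BH[OF z]] .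
    have "\<sigma> * Im (h z) = \<sigma> * Im ?w / (cmod (automorphy_denom (adj2 B) ?w))\<^sup>2"
      using Im_moebius[OF B' w] by (simp add: h_def)
    then show ?thesis using \<sigma>(2)[OF BH[OF z]] automorphy_denom_nonzero[OF B' w] by simp
  qed
  have h_dil: "h (of_real (m\<^sup>2) * z) = of_real (m\<^sup>2) * h z" if z: "Im z > 0" for z
  proof -
    have D: "moebius (mat2 m 0 0 (1 / m)) w = of_real (m\<^sup>2) * w" for w
      using m(1) by (simp add: moebius_def automorphy_denom_def power2_eq_square)
    show ?thesis using h_eqv[OF A0(1) conj_diag[OF B AB, symmetric] z] unfolding D .
  qed
  have holB: "moebius C holomorphic_on S" if "det C = 1" "\<And>z. z \<in> S \<Longrightarrow> Im z \<noteq> 0" for C S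
    unfolding holomorphic_on_def
    using moebius_has_field_derivative[OF that(1)] that(2) field_differentiable_at_within
      field_differentiable_def by blast
  have "(equivariant_map \<circ> moebius B) holomorphic_on upper_half_plane"
    by (rule holomorphic_on_compose_gen[OF holB[OF B] equivariant_map_holomorphic])
       (use BH in \<open>auto simp: upper_half_plane_def\<close>)
  then have "(moebius (adj2 B) \<circ> (equivariant_map \<circ> moebius B)) holomorphic_on upper_half_plane"
    by (rule holomorphic_on_compose_gen[OF _ holB[OF B', of "{z. Im z \<noteq> 0}"]])
       (use BH Im_equivariant_map_nonzero in \<open>auto simp: upper_half_plane_def\<close>)
  then have h_hol: "h holomorphic_on upper_half_plane" by (simp add: h_def[abs_def] o_def)
  obtain r0 where r0: "r0 > 0" "\<And>z. Im z > 0 \<Longrightarrow> of_real \<sigma> * h z = of_real r0 * z"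
  proof (rule dilation_equivariant_selfmap[of "\<lambda>z. of_real \<sigma> * h z" "m\<^sup>2"])
    show "(\<lambda>z. of_real \<sigma> * h z) holomorphic_on upper_half_plane" by (intro holomorphic_intros h_hol)
  qed (use h_sign h_dil m that in auto)
  define r where "r = \<sigma> * r0"
  have r: "r \<noteq> 0" using r0(1) \<sigma>(1) by (auto simp: r_def)
  have hr: "h z = of_real r * z" if z: "Im z > 0" for z
  proof -
    have "of_real \<sigma> * (of_real \<sigma> * h z) = h z" using \<sigma>(1) by auto
    then show ?thesis using r0(2)[OF z] by (simp add: r_def mult.assoc)
  qed
  show False
  proof (cases "r = 1")
    case True
    obtain z where z: "Im z > 0" "f z \<noteq> 0"
    proof -
      have "\<forall>\<^sub>F w in at \<i>. w \<in> upper_half_plane"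
        by (intro eventually_at_in_open' open_upper_half_plane) (simp add: upper_half_plane_def)
      then have "\<forall>\<^sub>F w in at \<i>. w \<in> upper_half_plane \<and> f w \<noteq> 0"
        by (rule eventually_conj) (use eventually_nonzero[of \<i>] in simp)
      then obtain w where "w \<in> upper_half_plane \<and> f w \<noteq> 0"
        using eventually_happens by fastforce
      then show ?thesis using that[of w] by (simp add: upper_half_plane_def)
    qed
    define w where "w = moebius (adj2 B) z"
    have w: "Im w > 0" "moebius B w = z"
      using Im_moebius_pos[OF B' z(1)] moebius_adj2(2)[OF B, of z] z(1) by (simp_all add: w_def)
    have "moebius (adj2 B) (equivariant_map z) = w" using hr[OF w(1)] True by (simp add: h_def w(2))
    then have "equivariant_map z = z"
      using moebius_adj2(2)[OF B Im_equivariant_map_nonzero[OF z(1)]] w(2) by simp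
    then show False using z(2) k deriv_nonzero[OF z] by (simp add: equivariant_map_def)
  next
    case False
    have "M $ 1 $ 1 * M $ 2 $ 1 = 0 \<and> M $ 1 $ 2 * M $ 2 $ 2 = 0" if A: "A \<in> G" and M: "M = adj2 B ** A ** B" for A M
    proof -
      have dM: "det M = 1" using det1[OF A] B by (simp add: M det_mul)
      \<comment> \<open>The real part of the cross-multiplied equation r M(z) = M(r z) at z = i
        y.\<close>
      have key: "r * (M $ 1 $ 2 * M $ 2 $ 2) - r\<^sup>2 * (M $ 1 $ 1 * M $ 2 $ 1) * y\<^sup>2 =
        M $ 1 $ 2 * M $ 2 $ 2 - r * (M $ 1 $ 1 * M $ 2 $ 1) * y\<^sup>2" if y: "y > 0" for y
      proof -
        define z where "z = of_real y * \<i>"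
        have z: "Im z > 0" using y by (simp add: z_def)
        have rz: "Im (of_real r * z) \<noteq> 0" using z r by simp
        have "of_real r * moebius M z = moebius M (of_real r * z)"
          using h_eqv[OF A M z] hr[OF z] hr[OF Im_moebius_pos[OF dM z]] by simp
        then have "of_real r * (moebius M z * automorphy_denom M z) * automorphy_denom M (of_real r * z) =
          (moebius M (of_real r * z) * automorphy_denom M (of_real r * z)) * automorphy_denom M z"
          by (simp add: mult_ac)
        then have e: "of_real r * (of_real (M $ 1 $ 1) * z + of_real (M $ 1 $ 2)) * automorphy_denom M (of_real r * z) =
          (of_real (M $ 1 $ 1) * (of_real r * z) + of_real (M $ 1 $ 2)) * automorphy_denom M z"
          using moebius_mult_denom[OF dM, of z] moebius_mult_denom[OF dM rz] z by simp
        show ?thesis using arg_cong[OF e, of Re]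
          by (simp add: automorphy_denom_def z_def power2_eq_square algebra_simps)
      qed
      define P Q where "P = M $ 1 $ 1 * M $ 2 $ 1" and "Q = M $ 1 $ 2 * M $ 2 $ 2"
      note key = key[folded P_def Q_def]
      \<comment> \<open>Two values of y^2 suffice: subtracting isolates P, and r \<noteq> 0, r
        \<noteq> 1 then give P = 0 and Q = 0.\<close>
      have k1: "r * Q - r\<^sup>2 * P = Q - r * P" using key[of 1] by simp
      have k2: "r * Q - r\<^sup>2 * P * 4 = Q - r * P * 4" using key[of 2] by simp
      have "r\<^sup>2 * P = r * P" using k1 k2 by linarith
      then have "P = 0" using r False by (simp add: power2_eq_square)
      moreover from this have "Q = 0" using k1 False by simp
      ultimately show ?thesis by (simp add: P_def Q_def)
    qed
    then show False using orbit_not_in_axis[OF B] by (auto simp: Let_def)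
  qed
qed

end

section \<open>Fuchsian groups of the first kind\<close>

text \<open>Since |c| Im w \<le> |c w + d|, the comparison constant does not depend on A. This
  carries accumulation over from one orbit to another.\<close>

lemma automorphy_denom_compare:
  assumes "Im w > 0"
  shows "cmod (automorphy_denom A z) \<le> cmod (automorphy_denom A w) * (1 + cmod (z - w) / Im w)"
proof -
  let ?c = "A $ 2 $ 1"
  have "\<bar>?c\<bar> * Im w = \<bar>Im (automorphy_denom A w)\<bar>" using assms by (simp add: automorphy_denom_def abs_mult)
  also have "\<dots> \<le> cmod (automorphy_denom A w)" by (rule abs_Im_le_cmod)
  finally have c: "\<bar>?c\<bar> \<le> cmod (automorphy_denom A w) / Im w" using assms by (simp add: field_simps)
  have "automorphy_denom A z = automorphy_denom A w + of_real ?c * (z - w)"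
    by (simp add: automorphy_denom_def algebra_simps)
  then have "cmod (automorphy_denom A z) \<le> cmod (automorphy_denom A w) + \<bar>?c\<bar> * cmod (z - w)"
    by (metis norm_mult norm_of_real norm_triangle_ineq)
  also have "\<dots> \<le> cmod (automorphy_denom A w) + cmod (automorphy_denom A w) / Im w * cmod (z - w)"
    using c by (intro add_left_mono mult_right_mono) auto
  finally show ?thesis by (simp add: algebra_simps)
qed

section \<open>From cosets to matrices\<close>

lemma Union_subset_PSL2R:
  assumes "\<Gamma> \<subseteq> carrier PSL2R" "A \<in> \<Union>\<Gamma>"
  shows "det A = 1" "{A, - A} \<in> \<Gamma>"
proof -
  obtain X where X: "X \<in> \<Gamma>" "A \<in> X" using assms(2) by blast
  then obtain B where B: "X = {B, - B}" "det B = 1" using assms(1) by (auto simp: carrier_PSL2R)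
  then show "det A = 1" using X(2) by (auto simp: det_uminus_2)
  have "X = {A, - A}" using B(1) X(2) by auto
  then show "{A, - A} \<in> \<Gamma>" using X(1) by simp
qed

lemma mult_PSL2R: "X \<otimes>\<^bsub>PSL2R\<^esub> Y = {A ** B | A B. A \<in> X \<and> B \<in> Y}"
  by (auto simp: PSL2R_def FactGroup_def set_mult_def SL2R_def)

lemma one_PSL2R: "\<one>\<^bsub>PSL2R\<^esub> = {mat 1, - mat 1}"
  by (simp add: PSL2R_def FactGroup_def)

lemma Union_subgroup_mult:
  assumes "subgroup \<Gamma> PSL2R" "A \<in> \<Union>\<Gamma>" "B \<in> \<Union>\<Gamma>"
  shows "A ** B \<in> \<Union>\<Gamma>"
proof -
  obtain X Y where XY: "X \<in> \<Gamma>" "A \<in> X" "Y \<in> \<Gamma>" "B \<in> Y" using assms(2,3) by blast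
  then have "A ** B \<in> X \<otimes>\<^bsub>PSL2R\<^esub> Y" unfolding mult_PSL2R by blast
  then show ?thesis using subgroup.m_closed[OF assms(1) XY(1,3)] by blast
qed

lemma Union_subgroup_adj2:
  assumes "subgroup \<Gamma> PSL2R" "A \<in> \<Union>\<Gamma>"
  shows "adj2 A \<in> \<Union>\<Gamma>"
proof -
  interpret group PSL2R by (rule group_PSL2R)
  have sub: "\<Gamma> \<subseteq> carrier PSL2R" using subgroup.subset[OF assms(1)] .
  note A = Union_subset_PSL2R[OF sub assms(2)]
  have i: "inv\<^bsub>PSL2R\<^esub> {A, - A} \<in> \<Gamma>" using subgroup.m_inv_closed[OF assms(1) A(2)] .
  then obtain C where C: "inv\<^bsub>PSL2R\<^esub> {A, - A} = {C, - C}" using sub by (auto simp: carrier_PSL2R)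
  have "{A, - A} \<otimes>\<^bsub>PSL2R\<^esub> {C, - C} = {mat 1, - mat 1}"
    using r_inv[of "{A, - A}"] A(2) sub C one_PSL2R by auto
  then have AC: "A ** C = mat 1 \<or> A ** C = - mat 1" unfolding mult_PSL2R by blast
  have "C = adj2 A ** (A ** C)" using adj2_mult(1)[OF A(1)] by (simp add: matrix_mul_assoc)
  then have "C = adj2 A \<or> - C = adj2 A" using AC by (auto simp: matrix_mult_uminus)
  then show ?thesis using i C by auto
qed

lemma continuous_adj2_mult: "continuous_on UNIV (\<lambda>p::(real^2^2) \<times> (real^2^2). adj2 (fst p) ** snd p)"
proof -
  have a: "continuous_on UNIV (\<lambda>p::(real^2^2) \<times> (real^2^2). adj2 (fst p) $ i $ j)" for i j
    using exhaust_2[of i] exhaust_2[of j] by (elim disjE; simp; intro continuous_intros)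
  have "(\<lambda>p::(real^2^2) \<times> (real^2^2). adj2 (fst p) ** snd p) =
      (\<lambda>p. \<chi> i j. adj2 (fst p) $ i $ 1 * snd p $ 1 $ j + adj2 (fst p) $ i $ 2 * snd p $ 2 $ j)"
    by (rule ext) (simp add: vec_eq_iff mult2_nth)
  then show ?thesis by (simp only:) (intro continuous_on_vec_lambda continuous_intros a)
qed

text \<open>The identity coset is relatively open in \<Gamma>, and open sets of cosets are those
  with open preimage among the matrices.\<close>

lemma fuchsian_group_isolated_identity:
  assumes "fuchsian_group \<Gamma>"
  shows "\<exists>T. open T \<and> mat 1 \<in> T \<and> (\<forall>C\<in>\<Union>\<Gamma> \<inter> T. C = mat 1 \<or> C = - mat 1)"
proof -
  have sg: "subgroup \<Gamma> PSL2R" and disc: "subtopology PSL2R_topology \<Gamma> = discrete_topology \<Gamma>"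
    using assms by (auto simp: fuchsian_group_def)
  have sub: "\<Gamma> \<subseteq> carrier PSL2R" using subgroup.subset[OF sg] .
  have one: "{mat 1, - mat 1} \<in> \<Gamma>" using subgroup.one_closed[OF sg] by (simp add: one_PSL2R)
  then have "openin (subtopology PSL2R_topology \<Gamma>) {{mat 1, - mat 1}}" unfolding disc by simp
  then obtain U where U: "openin PSL2R_topology U" "{{mat 1, - mat 1}} = U \<inter> \<Gamma>"
    unfolding openin_subtopology by blast
  then obtain T where UC: "U \<subseteq> carrier PSL2R" and T: "open T" "\<Union>U = carrier SL2R \<inter> T"
    unfolding openin_PSL2R_topology openin_open by blast
  have "mat 1 \<in> \<Union>U" using U(2) by blast
  then have "mat 1 \<in> T" using T(2) by blast
  moreover have "C = mat 1 \<or> C = - mat 1" if C: "C \<in> \<Union>\<Gamma>" "C \<in> T" for C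
  proof -
    note C' = Union_subset_PSL2R[OF sub C(1)]
    have "C \<in> \<Union>U" using T(2) C C'(1) by (simp add: SL2R_def)
    then have "{C, - C} \<in> U" using Union_subset_PSL2R(2)[OF UC] by blast
    then have "{C, - C} \<in> {{mat 1, - mat 1}}" unfolding U(2) using C'(2) by (rule IntI)
    then have "C \<in> {mat 1, - mat 1}" by (metis insertI1 singletonD)
    then show ?thesis by simp
  qed
  ultimately show ?thesis using T(1) by blast
qed

text \<open>An infinite bounded set would accumulate at some L of determinant 1. For A and B near L,
  the quotient A^-1 B is near the identity, hence equal to it, so only one element lies near
  L.\<close>

lemma fuchsian_group_finite_bounded:
  assumes "fuchsian_group \<Gamma>"
  shows "finite {A \<in> \<Union>\<Gamma>. \<forall>i j. \<bar>A $ i $ j\<bar> \<le> R}"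
proof (rule ccontr)
  define S where "S = {A \<in> \<Union>\<Gamma>. \<forall>i j. \<bar>A $ i $ j\<bar> \<le> R}"
  assume "\<not> ?thesis"
  then have inf: "infinite S" by (simp add: S_def)
  have sg: "subgroup \<Gamma> PSL2R" using assms by (simp add: fuchsian_group_def)
  have det1: "det A = 1" if "A \<in> S" for A
    using that Union_subset_PSL2R(1)[OF subgroup.subset[OF sg]] by (auto simp: S_def)
  have "norm A \<le> 4 * R" if "A \<in> S" for A
  proof -
    have b: "\<bar>A $ i $ j\<bar> \<le> R" for i j using that by (simp add: S_def)
    have "norm A \<le> (\<Sum>i\<in>UNIV. \<Sum>j\<in>UNIV. \<bar>A $ i $ j\<bar>)"
      by (rule order_trans[OF _ sum_mono[OF norm_le_l1_cart]])
         (simp add: norm_vec_def[of A] L2_set_le_sum)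
    also have "\<dots> \<le> 4 * R" using b[of 1 1] b[of 1 2] b[of 2 1] b[of 2 2] by (simp add: sum_2)
    finally show ?thesis .
  qed
  then have "bounded S" by (auto simp: bounded_iff)
  then obtain L where L: "L islimpt S" using inf bounded_infinite_imp_islimpt by blast
  have "closed {A::real^2^2. A $ 1 $ 1 * A $ 2 $ 2 - A $ 1 $ 2 * A $ 2 $ 1 = 1}"
    by (intro closed_Collect_eq continuous_intros)
  then have "closed {A::real^2^2. det A = 1}" by (simp add: det_2)
  moreover have "S \<subseteq> {A. det A = 1}" using det1 by (intro subsetI CollectI)
  then have "L islimpt {A. det A = 1}" by (rule islimpt_subset[OF L])
  ultimately have "L \<in> {A. det A = 1}" unfolding closed_limpt by blast
  then have "det L = 1" by (rule CollectD)
  then have LL: "adj2 L ** L = mat 1" by (rule adj2_mult)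
  obtain T where T: "open T" "mat 1 \<in> T" "\<And>C. C \<in> \<Union>\<Gamma> \<Longrightarrow> C \<in> T \<Longrightarrow> C = mat 1 \<or> C = - mat 1"
    using fuchsian_group_isolated_identity[OF assms] by blast
  \<comment> \<open>Positivity of the upper left entry excludes the second preimage - 1 of the
    identity.\<close>
  define T' where "T' = T \<inter> {C. C $ 1 $ 1 > 0}"
  have "open T'" unfolding T'_def by (intro open_Int T open_Collect_less continuous_intros)
  then have "open ((\<lambda>p. adj2 (fst p) ** snd p) -` T')"
    using continuous_adj2_mult by (simp add: continuous_on_open_vimage)
  moreover have "(L, L) \<in> (\<lambda>p. adj2 (fst p) ** snd p) -` T'" using T(2) by (simp add: LL T'_def mat1_nth2)
  ultimately obtain V W where VW: "open V" "open W" "(L, L) \<in> V \<times> W" "V \<times> W \<subseteq> (\<lambda>p. adj2 (fst p) ** snd p) -` T'"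
    by (rule open_prod_elim)
  then have "open (V \<inter> W)" "L \<in> V \<inter> W" by auto
  then have "infinite (V \<inter> W \<inter> S)" using L unfolding islimpt_eq_acc_point by blast
  then have infVW: "infinite (S \<inter> (V \<inter> W))" by (simp add: Int_ac)
  then obtain A where A: "A \<in> S" "A \<in> V \<inter> W"
    using infinite_imp_nonempty by blast
  have "B = A" if B: "B \<in> S" "B \<in> V \<inter> W" for B
  proof -
    have "adj2 A ** B \<in> T'" using A(2) B(2) VW(4) by force
    then have C: "adj2 A ** B \<in> T" "(adj2 A ** B) $ 1 $ 1 > 0" by (auto simp: T'_def)
    have "adj2 A ** B \<in> \<Union>\<Gamma>"
      using A(1) B(1) by (intro Union_subgroup_mult[OF sg] Union_subgroup_adj2[OF sg]) (auto simp: S_def)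
    then have "adj2 A ** B = mat 1 \<or> adj2 A ** B = - mat 1" using T(3) C(1) by blast
    moreover have "adj2 A ** B \<noteq> - mat 1" using C(2) by (auto simp: mat1_nth2)
    ultimately have "A ** (adj2 A ** B) = A" by simp
    then show ?thesis using adj2_mult(2)[OF det1[OF A(1)]] by (simp add: matrix_mul_assoc)
  qed
  then have "S \<inter> (V \<inter> W) \<subseteq> {A}" by blast
  then show False using infVW finite_subset by blast
qed

text \<open>The limit set provides, for each x, some orbit accumulating there. For any other w the
  distance |A w - A z| = |w - z| / (|c w + d| |c z + d|) is at most K times Im (A z), which is small
  when A z is near x.\<close>

lemma first_kind_orbit_dense:
  assumes \<Gamma>: "\<Gamma> \<subseteq> carrier PSL2R" and fk: "first_kind \<Gamma>" and w: "Im w > 0" and e: "\<epsilon> > 0"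
  shows "\<exists>A\<in>\<Union>\<Gamma>. cmod (moebius A w - of_real x) < \<epsilon>"
proof -
  have "Some (complex_of_real x) \<in> limit_set \<Gamma>" using fk by (simp add: first_kind_def)
  then obtain z where z: "Im z > 0"
    and lim: "Some (complex_of_real x) \<in> Alexandroff_compactification euclidean derived_set_of (Some ` orbit \<Gamma> z)"
    by (auto simp: limit_set_def upper_half_plane_def)
  define q where "q = 1 + cmod (z - w) / Im w"
  have q: "q \<ge> 1" using w by (simp add: q_def)
  define K where "K = cmod (w - z) * q / Im z"
  have K: "K \<ge> 0" using q z by (simp add: K_def)
  define \<delta> where "\<delta> = \<epsilon> / (1 + K)"
  have \<delta>: "\<delta> > 0" "\<delta> * (1 + K) = \<epsilon>" using e K by (auto simp: \<delta>_def)
  have "openin (Alexandroff_compactification euclidean) (Some ` ball (complex_of_real x) \<delta>)" by simp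
  moreover have "Some (complex_of_real x) \<in> Some ` ball (complex_of_real x) \<delta>" using \<delta>(1) by simp
  ultimately have "\<exists>y\<in>Some ` orbit \<Gamma> z. y \<in> Some ` ball (complex_of_real x) \<delta>"
    using lim unfolding in_derived_set_of by blast
  then obtain v where "v \<in> orbit \<Gamma> z" and v: "dist (complex_of_real x) v < \<delta>" by auto
  then obtain A where "A \<in> \<Union>\<Gamma>" "v = moebius A z" unfolding orbit_def by blast
  with v have A: "A \<in> \<Union>\<Gamma>" "cmod (moebius A z - of_real x) < \<delta>"
    by (simp_all add: dist_norm norm_minus_commute)
  have dA: "det A = 1" using Union_subset_PSL2R(1)[OF \<Gamma> A(1)] .
  define Dz Dw where "Dz = automorphy_denom A z" and "Dw = automorphy_denom A w"
  have nz: "Dz \<noteq> 0" "Dw \<noteq> 0" using automorphy_denom_nonzero[OF dA] z w by (auto simp: Dz_def Dw_def)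
  have "Im (moebius A z) < \<delta>" using A(2) abs_Im_le_cmod[of "moebius A z - of_real x"] by simp
  then have "Im z / (cmod Dz)\<^sup>2 < \<delta>" using Im_moebius[OF dA] z by (simp add: Dz_def)
  then have i: "1 / (cmod Dz)\<^sup>2 \<le> \<delta> / Im z" using z nz by (simp add: field_simps)
  have "cmod Dz \<le> cmod Dw * q" unfolding Dz_def Dw_def q_def by (rule automorphy_denom_compare[OF w])
  then have j: "1 / cmod Dw \<le> q / cmod Dz" using nz by (simp add: field_simps)
  have "cmod (moebius A w - moebius A z) = cmod (w - z) * (1 / cmod Dw) * (1 / cmod Dz)"
    using moebius_diff[OF dA, of w z] nz by (simp add: Dz_def Dw_def norm_divide norm_mult)
  also have "\<dots> \<le> cmod (w - z) * (q / cmod Dz) * (1 / cmod Dz)"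
    using j by (intro mult_right_mono mult_left_mono) auto
  also have "\<dots> = cmod (w - z) * q * (1 / (cmod Dz)\<^sup>2)" by (simp add: power2_eq_square)
  also have "\<dots> \<le> cmod (w - z) * q * (\<delta> / Im z)" using i q by (intro mult_left_mono) auto
  also have "\<dots> = \<delta> * K" by (simp add: K_def)
  finally have "cmod (moebius A w - moebius A z) \<le> \<delta> * K" .
  moreover have "cmod (moebius A w - of_real x) \<le> cmod (moebius A w - moebius A z) + cmod (moebius A z - of_real x)"
    using norm_triangle_ineq[of "moebius A w - moebius A z" "moebius A z - of_real x"] by simp
  ultimately have "cmod (moebius A w - of_real x) < \<epsilon>" using A(2) \<delta>(2) by (simp add: algebra_simps)
  then show ?thesis using A(1) by blast
qed

theorem theorem11p1:
  fixes \<Gamma> :: "(real^2^2) set set" and k :: real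
    and \<nu> :: "real^2^2 \<Rightarrow> complex" and f :: "complex \<Rightarrow> complex"
  assumes "fuchsian_group \<Gamma>" and "first_kind \<Gamma>"
    and "k \<noteq> 0"
    and "multiplier_system \<Gamma> k \<nu>"
    and "f \<in> unrestricted_forms \<Gamma> k \<nu>"
  shows "\<exists>S. S \<subseteq> critical_points f \<and> infinite S \<and>
           pairwise (\<lambda>z w. \<not> equivalent_points \<Gamma> z w) S"
proof (rule ccontr)
  assume no: "\<not> ?thesis"
  have sg: "subgroup \<Gamma> PSL2R" using assms(1) by (simp add: fuchsian_group_def)
  have sub: "\<Gamma> \<subseteq> carrier PSL2R" using subgroup.subset[OF sg] .
  interpret dense_orbit_group "\<Union>\<Gamma>"
    using Union_subset_PSL2R(1)[OF sub] Union_subgroup_mult[OF sg] Union_subgroup_adj2[OF sg]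
      fuchsian_group_finite_bounded[OF assms(1)] first_kind_orbit_dense[OF sub assms(2)]
    by unfold_locales blast+
  have nu: "\<nu> A \<noteq> 0" if "A \<in> \<Union>\<Gamma>" for A
    using assms(4) that by (force simp: multiplier_system_def)
  have form: "f nicely_meromorphic_on upper_half_plane"
    "\<And>A z. A \<in> \<Union>\<Gamma> \<Longrightarrow> Im z > 0 \<Longrightarrow>
       automorphy_denom A z powr (- of_real k) * f (moebius A z) = \<nu> A * f z"
    using assms(5) by (auto simp: unrestricted_forms_def upper_half_plane_def)
  \<comment> \<open>The negated conclusion enters here, in the form of local finiteness.\<close>
  have fin: "finite {z \<in> K. \<exists>A\<in>\<Union>\<Gamma>. moebius A z \<in> critical_points f}"
    if K: "compact K" "K \<subseteq> upper_half_plane" for K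
  proof (rule ccontr)
    assume "infinite {z \<in> K. \<exists>A\<in>\<Union>\<Gamma>. moebius A z \<in> critical_points f}"
    then have "\<exists>S\<subseteq>critical_points f. infinite S \<and> pairwise (\<lambda>z w. \<not> (\<exists>A\<in>\<Union>\<Gamma>. w = moebius A z)) S"
      by (rule infinite_inequivalent_subset[OF K]) (auto simp: critical_points_def)
    moreover have "equivalent_points \<Gamma> z w \<longleftrightarrow> (\<exists>A\<in>\<Union>\<Gamma>. w = moebius A z)" for z w
      by (auto simp: equivalent_points_def orbit_def)
    ultimately show False using no by simp
  qed
  interpret finitely_critical_form "\<Union>\<Gamma>" k \<nu> f
    by unfold_locales (use assms(3) nu form fin in blast)+
  show False by (rule finitely_critical_form_impossible)
qed

end
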